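(* Let $k$ be a field of characteristic zero, $\mathcal O$ a complete discrete valuation $k$-algebra with residue field $k$, with maximal ideal $\mathfrak m$ and fraction field $K$. Let $\eta\in(\hat\Omega^{(2)})^\sigma$ have biresidue constant equal to $1$. Then $\operatorname{Res}_{1\to2}\big(\pi_1^*(f)\eta\big)=df$ for every $f\in K$. Furthermore, the map $$S_\eta\colon K\to\Omega_K,\qquad f\mapsto\operatorname{Res}_1\big(\pi_1^*(f)\eta\big)$$ is zero on $\mathcal O$ and its image is a Lagrangian supplement of $\Omega$ in $\Omega'_K$. If the universal derivation $d$ is used to identify $K'$ with $\Omega'_K$, so that $S_\eta$ factors through an endomorphism $S'_\eta$ of $K'$, then $-S'_\eta$ is a projector with kernel $\mathfrak m'$ and with image a Lagrangian supplement $L_\eta$ of $\mathfrak m'$ in $K'$. In particular, $f\mapsto\operatorname{Res}_{1\to2}\big(\pi_1^*(f)\eta\big)+\operatorname{Res}_1\big(\pi_1^*(f)\eta\big)$ factors (via the same identification) through a Lagrangian projection $\Pi_\eta$ of $K'$ onto $\mathfrak m'$ with kernel $L_\eta$. The assignment $\eta\mapsto L_\eta$ establishes an isomorphism between the set of elements of $(\hat\Omega^{(2)})^\sigma$ with biresidue $1$ and the space of Lagrangian supplements of $\mathfrak m'$ in $K'$. This is an isomorphism of $(\Omega^{(2)})^\sigma$-torsors.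
   Context: Let $d\colon\mathcal O\to\Omega$ be the universal continuous $k$-derivation ($\mathfrak m$-adic topology) and $\Omega_K=K\otimes_{\mathcal O}\Omega$. A uniformizer $t$ identifies $\mathcal O=k[[t]]$, $K=k((t))$, $\Omega=\mathcal O\,dt$. The residue $\operatorname{Res}\colon\Omega_K\to k$ takes $\sum_ia_it^{i-1}dt$ to $a_0$. Put $K':=K/k$, $\Omega'_K:=\ker(\operatorname{Res}\colon\Omega_K\to k)$; $d$ induces an isomorphism $K'\cong\Omega'_K$. The pairing $\langle f|g\rangle:=\operatorname{Res}(f\,dg)$ is antisymmetric on $K$ with kernel $k$ and makes $K'$ a topological symplectic space; $\Omega'_K$ receives this symplectic form via $d$. $\mathfrak m'$ denotes the image of $\mathfrak m$ (equivalently of $\mathcal O$) in $K'$; it is a Lagrangian subspace, mapped by $d$ isomorphically onto $\Omega$. A Lagrangian subspace is one equal to its own annihilator; a Lagrangian supplement of $\mathfrak m'$ is a Lagrangian subspace $L\subset K'$ with $K'=\mathfrak m'\oplus L$; a Lagrangian projection onto $\mathfrak m'$ is a linear projection with image $\mathfrak m'$ and Lagrangian kernel. $\mathcal O^{(2)}$ and $K^{(2)}$ are the completions of $\mathcal O\otimes_k\mathcal O$, $K\otimes_kK$, i.e. formal series $\sum a_{k_1,k_2}t_1^{k_1}t_2^{k_2}$ with $a_{k_1,k_2}=0$ whenever $\min\{k_1,k_2\}$ is less than $0$, respectively less than some integer (depending on the series). $\mathcal I_\Delta=(t_1-t_2)\subset\mathcal O^{(2)}$ is the ideal of the diagonal.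 $\Omega^{(2)}=\mathcal O^{(2)}dt_1dt_2$ and $\Omega^{(2)}_{K^{(2)}}=K^{(2)}dt_1dt_2$ are the modules of bidifferentials, with the convention $dt_1dt_2=dt_2dt_1$. The involution $\sigma$ exchanges the two factors. For $f\in K$, $\pi_1^*(f)=f(t_1)$. Expand an element of $\bigcup_{n}\mathcal I_\Delta^{-n}\Omega^{(2)}_{K^{(2)}}$ as $\sum_{n\ge n_0}(t_1-t_2)^nf_n(t_2)\,dt_1dt_2$, $f_n\in K$. Its biresidue is $f_{-2}(t)\in K$, and $\operatorname{Res}_{1\to2}$ takes it to $f_{-1}(t)\,dt\in\Omega_K$. The map $\operatorname{Res}_1$ takes it to the element of $\Omega_K$ obtained by expanding negative powers of $t_1-t_2$ with $t_1$ small compared with $t_2$ (so $(t_1-t_2)^{-1}=-\sum_{i\ge0}t_1^it_2^{-1-i}$) and then taking the coefficient of $t_1^{-1}dt_1$ (a differential in the variable $t_2$, which is then renamed $t$). These notions do not depend on the choice of $t$. $\hat\Omega^{(2)}$ is the preimage of $k$ under the biresidue map $\mathcal I_\Delta^{-2}\Omega^{(2)}\to K$, and $(\cdot)^\sigma$ denotes $\sigma$-invariants. Torsor structures: $(\Omega^{(2)})^\sigma$ acts by translation on the elements of $(\hat\Omega^{(2)})^\sigma$ with biresidue $1$. For $\xi\in(\Omega^{(2)})^\sigma$ let $\rho(\xi)$ be the symplectic transformation of $K'$ given by $f\mapsto f+d^{-1}\operatorname{Res}_1(\pi_1^*(f)\xi)$, which is the identity on $\mathfrak m'$; $\xi$ acts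 on Lagrangian projections $\Pi$ onto $\mathfrak m'$ by $\Pi\mapsto\Pi\circ\rho(\xi)$, equivalently on Lagrangian supplements by $L\mapsto\rho(\xi)^{-1}(L)$. *)

theory Defs
  imports "HOL-Computational_Algebra.Computational_Algebra"
begin

section \<open>Complete discrete valuation algebras with coefficient field \<open>k\<close>\<close>

definition max_ideal :: "'o::idom set" where
  "max_ideal = {x. \<not> x dvd 1}"

text \<open>
  The irreducible elements of a discrete valuation ring are its uniformizers. If \<open>p\<close> is one of them,
  the \<open>n\<close>-th power of the maximal ideal is the set of multiples of \<open>p ^ n\<close>; this is how
  completeness is expressed below.
\<close>

locale complete_dv_algebra =
  fixes \<iota> :: "'k::field_char_0 \<Rightarrow> 'o::idom"
  assumes iota_one: "\<iota> 1 = 1"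
    and iota_add: "\<iota> (a + b) = \<iota> a + \<iota> b"
    and iota_mult: "\<iota> (a * b) = \<iota> a * \<iota> b"
    and discrete_valuation_ring:
      "\<exists>p::'o. irreducible p \<and> (\<forall>x. x \<noteq> 0 \<longrightarrow> (\<exists>u n. u dvd 1 \<and> x = u * p ^ n))"
    and complete:
      "irreducible (p::'o) \<Longrightarrow> (\<And>n. \<exists>N. \<forall>i\<ge>N. \<forall>j\<ge>N. p ^ n dvd (X :: nat \<Rightarrow> 'o) i - X j)
        \<Longrightarrow> \<exists>x. \<forall>n. \<exists>N. \<forall>i\<ge>N. p ^ n dvd X i - x"
    and residue_field: "\<exists>!c. x - \<iota> c \<in> max_ideal"

text \<open>
  The identifications of the algebra with \<open>k[[t]]\<close> and of its fraction field with \<open>k((t))\<close>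
  given by a uniformizer \<open>t\<close>.
\<close>

definition power_series_expansion :: "('k::field_char_0 \<Rightarrow> 'o::idom) \<Rightarrow> 'o \<Rightarrow> 'o \<Rightarrow> 'k fps" where
  "power_series_expansion \<iota> t x =
     (THE p. \<forall>n. t ^ n dvd x - (\<Sum>i<n. \<iota> (fps_nth p i) * t ^ i))"

definition laurent_expansion :: "('k::field_char_0 \<Rightarrow> 'o::idom) \<Rightarrow> 'o \<Rightarrow> 'o fract \<Rightarrow> 'k fls" where
  "laurent_expansion \<iota> t f =
     (THE F. \<exists>a b. b \<noteq> 0 \<and> f = Fract a b \<and>
        F = fps_to_fls (power_series_expansion \<iota> t a) / fps_to_fls (power_series_expansion \<iota> t b))"

definition scale_K :: "('k::field_char_0 \<Rightarrow> 'o::idom) \<Rightarrow> 'k \<Rightarrow> 'o fract \<Rightarrow> 'o fract" where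
  "scale_K \<iota> c f = to_fract (\<iota> c) * f"

text \<open>
  The quotient space \<open>K' = K/k\<close> enters through an arbitrary model: a \<open>k\<close>-vector space \<open>'v\<close>
  (scalar multiplication \<open>scale\<close>) with a surjective linear map \<open>q\<close> whose kernel is \<open>k\<close>.
\<close>

definition quotient_by_constants ::
  "('k::field_char_0 \<Rightarrow> 'o::idom) \<Rightarrow> ('k \<Rightarrow> 'v::ab_group_add \<Rightarrow> 'v) \<Rightarrow> ('o fract \<Rightarrow> 'v) \<Rightarrow> bool" where
  "quotient_by_constants \<iota> scale q \<longleftrightarrow>
     Vector_Spaces.linear (scale_K \<iota>) scale q \<and> surj q \<and>
     (\<forall>f. q f = 0 \<longleftrightarrow> f \<in> range (\<lambda>c. to_fract (\<iota> c)))"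


section \<open>Differentials, residue and the symplectic form\<close>

text \<open>
  A differential \<open>h dt\<close> in \<open>\<Omega>\<^sub>K = k((t)) dt\<close> is represented by the series \<open>h\<close>. From here on,
  \<open>\<phi>\<close> stands for the identification of \<open>K\<close> with \<open>k((t))\<close>, and the residue of \<open>h dt\<close> is
  \<open>fls_residue h\<close>.
\<close>

definition scale_Omega :: "'k::field \<Rightarrow> 'k fls \<Rightarrow> 'k fls" where
  "scale_Omega c h = fls_const c * h"

definition Omega :: "'k::field fls set" where
  "Omega = range fps_to_fls"

definition Omega_K' :: "'k::field fls set" where
  "Omega_K' = {h. fls_residue h = 0}"

definition diff_K :: "('K \<Rightarrow> 'k::field fls) \<Rightarrow> 'K \<Rightarrow> 'k fls" where
  "diff_K \<phi> f = fls_deriv (\<phi> f)"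

definition pairing :: "('K \<Rightarrow> 'k::field fls) \<Rightarrow> 'K \<Rightarrow> 'K \<Rightarrow> 'k" where
  "pairing \<phi> f g = fls_residue (\<phi> f * diff_K \<phi> g)"

text \<open>
  The map through which \<open>S\<close> factors over the quotient map \<open>q\<close>, and the form which the pairing on
  \<open>K\<close> induces along \<open>p\<close>. The latter is used for \<open>p\<close> the quotient map \<open>K \<rightarrow> K'\<close> and for
  \<open>p = d : K \<rightarrow> \<Omega>'\<^sub>K\<close>.
\<close>

definition factor :: "('K \<Rightarrow> 'v) \<Rightarrow> ('K \<Rightarrow> 'w) \<Rightarrow> 'v \<Rightarrow> 'w" where
  "factor q S x = (THE y. \<exists>f. q f = x \<and> y = S f)"

definition induced_form :: "('K \<Rightarrow> 'k::field fls) \<Rightarrow> ('K \<Rightarrow> 'w) \<Rightarrow> 'w \<Rightarrow> 'w \<Rightarrow> 'k" where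
  "induced_form \<phi> p x y = (THE c. \<exists>f g. p f = x \<and> p g = y \<and> c = pairing \<phi> f g)"

definition diff_K' :: "('K \<Rightarrow> 'k::field fls) \<Rightarrow> ('K \<Rightarrow> 'v) \<Rightarrow> 'v \<Rightarrow> 'k fls" where
  "diff_K' \<phi> q = factor q (diff_K \<phi>)"

definition max_ideal' :: "('o::idom fract \<Rightarrow> 'v) \<Rightarrow> 'v set" where
  "max_ideal' q = q ` to_fract ` max_ideal"


section \<open>Lagrangian subspaces, supplements and projections\<close>

text \<open>Here \<open>W\<close> is the underlying symplectic space and \<open>\<omega>\<close> its form.\<close>

definition annihilator :: "'w set \<Rightarrow> ('w \<Rightarrow> 'w \<Rightarrow> 'k::zero) \<Rightarrow> 'w set \<Rightarrow> 'w set" where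
  "annihilator W \<omega> L = {x \<in> W. \<forall>y\<in>L. \<omega> x y = 0}"

definition lagrangian ::
  "('k::field \<Rightarrow> 'w::ab_group_add \<Rightarrow> 'w) \<Rightarrow> 'w set \<Rightarrow> ('w \<Rightarrow> 'w \<Rightarrow> 'k) \<Rightarrow> 'w set \<Rightarrow> bool" where
  "lagrangian scale W \<omega> L \<longleftrightarrow> module.subspace scale L \<and> L \<subseteq> W \<and> annihilator W \<omega> L = L"

definition lagrangian_supplement ::
  "('k::field \<Rightarrow> 'w::ab_group_add \<Rightarrow> 'w) \<Rightarrow> 'w set \<Rightarrow> ('w \<Rightarrow> 'w \<Rightarrow> 'k) \<Rightarrow> 'w set \<Rightarrow> 'w set \<Rightarrow> bool" where
  "lagrangian_supplement scale W \<omega> M L \<longleftrightarrow>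
     lagrangian scale W \<omega> L \<and> M \<inter> L = {0} \<and> {x + y | x y. x \<in> M \<and> y \<in> L} = W"

definition projector :: "('k::field \<Rightarrow> 'w::ab_group_add \<Rightarrow> 'w) \<Rightarrow> ('w \<Rightarrow> 'w) \<Rightarrow> bool" where
  "projector scale P \<longleftrightarrow> Vector_Spaces.linear scale scale P \<and> P \<circ> P = P"

definition lagrangian_projection ::
  "('k::field \<Rightarrow> 'w::ab_group_add \<Rightarrow> 'w) \<Rightarrow> ('w \<Rightarrow> 'w \<Rightarrow> 'k) \<Rightarrow> 'w set \<Rightarrow> ('w \<Rightarrow> 'w) \<Rightarrow> bool" where
  "lagrangian_projection scale \<omega> M P \<longleftrightarrow>
     projector scale P \<and> range P = M \<and> lagrangian scale UNIV \<omega> {x. P x = 0}"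


section \<open>Bidifferentials\<close>

text \<open>
  The ring \<open>K\<^sup>(\<^sup>2\<^sup>)\<close> is contained in the field \<open>k((t\<^sub>2))((t\<^sub>1))\<close>, which is the type \<open>'k fls fls\<close> with
  \<open>t\<^sub>1\<close> as the outer and \<open>t\<^sub>2\<close> as the inner variable. As \<open>t\<^sub>1 - t\<^sub>2\<close> is invertible in this field, so is
  its localization at \<open>t\<^sub>1 - t\<^sub>2\<close>, and this embedding is precisely the expansion of negative powers of
  \<open>t\<^sub>1 - t\<^sub>2\<close> with \<open>t\<^sub>1\<close> small compared with \<open>t\<^sub>2\<close>. A bidifferential \<open>F dt\<^sub>1 dt\<^sub>2\<close>, possibly with a
  pole on the diagonal, is represented by the element \<open>F\<close> of this field.
\<close>

definition bicoeff :: "'k::field fls fls \<Rightarrow> int \<Rightarrow> int \<Rightarrow> 'k" where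
  "bicoeff F i j = fls_nth (fls_nth F i) j"

definition t1 :: "'k::field fls fls" where
  "t1 = fls_X"

definition t2 :: "'k::field fls fls" where
  "t2 = fls_const fls_X"

definition pullback1 :: "'k::field fls \<Rightarrow> 'k fls fls" where
  "pullback1 f = Abs_fls (\<lambda>i. fls_const (fls_nth f i))"

definition pullback2 :: "'k::field fls \<Rightarrow> 'k fls fls" where
  "pullback2 f = fls_const f"

definition O2 :: "'k::field fls fls set" where
  "O2 = {F. \<forall>i j. min i j < 0 \<longrightarrow> bicoeff F i j = 0}"

definition K2 :: "'k::field fls fls set" where
  "K2 = {F. \<exists>N. \<forall>i j. min i j < N \<longrightarrow> bicoeff F i j = 0}"

text \<open>\<open>diag_power n M\<close> is the product of \<open>M\<close> with the \<open>n\<close>-th power of the ideal of the diagonal.\<close>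

definition diag_power :: "int \<Rightarrow> 'k::field fls fls set \<Rightarrow> 'k fls fls set" where
  "diag_power n M = (\<lambda>G. (t1 - t2) powi n * G) ` M"

text \<open>
  The expansion of \<open>F\<close> as \<open>\<Sum>\<^sub>n (t\<^sub>1 - t\<^sub>2)\<^sup>n f\<^sub>n(t\<^sub>2)\<close>, convergent for the adic topology of the ideal of
  the diagonal. It exists, and is unique, for \<open>F\<close> in any \<open>diag_power n K2\<close>.
\<close>

definition is_diag_expansion :: "'k::field fls fls \<Rightarrow> (int \<Rightarrow> 'k fls) \<Rightarrow> bool" where
  "is_diag_expansion F f \<longleftrightarrow>
     (\<exists>n0. (\<forall>n<n0. f n = 0) \<and>
       (\<forall>m. F - (\<Sum>n\<in>{n0..m}. (t1 - t2) powi n * pullback2 (f n)) \<in> diag_power (m + 1) K2))"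

definition diag_coeff :: "'k::field fls fls \<Rightarrow> int \<Rightarrow> 'k fls" where
  "diag_coeff F = (THE f. is_diag_expansion F f)"

definition biresidue :: "'k::field fls fls \<Rightarrow> 'k fls" where
  "biresidue F = diag_coeff F (-2)"

definition Res12 :: "'k::field fls fls \<Rightarrow> 'k fls" where
  "Res12 F = diag_coeff F (-1)"

definition Res1 :: "'k::field fls fls \<Rightarrow> 'k fls" where
  "Res1 F = fls_nth F (-1)"

text \<open>
  The involution \<open>\<sigma>\<close>. Exchanging coefficients describes it only on \<open>K2\<close>: on an element with a pole on
  the diagonal this would produce an expansion with \<open>t\<^sub>2\<close> small compared with \<open>t\<^sub>1\<close>. Since
  \<open>dt\<^sub>1 dt\<^sub>2 = dt\<^sub>2 dt\<^sub>1\<close>, there is no additional sign.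
\<close>

definition swap_K2 :: "'k::field fls fls \<Rightarrow> 'k fls fls" where
  "swap_K2 G = (THE H. \<forall>i j. bicoeff H i j = bicoeff G j i)"

definition involution :: "'k::field fls fls \<Rightarrow> 'k fls fls" where
  "involution F =
     (THE H. \<exists>n::int. \<exists>G\<in>K2. F = (t1 - t2) powi n * G \<and> H = (t2 - t1) powi n * swap_K2 G)"

definition Omega2_sym :: "'k::field fls fls set" where
  "Omega2_sym = {\<xi> \<in> O2. involution \<xi> = \<xi>}"

definition Omega2_hat :: "'k::field fls fls set" where
  "Omega2_hat = {\<eta> \<in> diag_power (-2) O2. \<exists>c. biresidue \<eta> = fls_const c}"

definition Omega2_hat_sym :: "'k::field fls fls set" where
  "Omega2_hat_sym = {\<eta> \<in> Omega2_hat. involution \<eta> = \<eta>}"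

definition Omega2_hat_sym_1 :: "'k::field fls fls set" where
  "Omega2_hat_sym_1 = {\<eta> \<in> Omega2_hat_sym. biresidue \<eta> = fls_const 1}"


section \<open>The operators attached to a bidifferential\<close>

definition S_op :: "('K \<Rightarrow> 'k::field fls) \<Rightarrow> 'k fls fls \<Rightarrow> 'K \<Rightarrow> 'k fls" where
  "S_op \<phi> \<eta> f = Res1 (pullback1 (\<phi> f) * \<eta>)"

definition R_op :: "('K \<Rightarrow> 'k::field fls) \<Rightarrow> 'k fls fls \<Rightarrow> 'K \<Rightarrow> 'k fls" where
  "R_op \<phi> \<eta> f = Res12 (pullback1 (\<phi> f) * \<eta>)"

text \<open>
  The endomorphism of \<open>K'\<close> obtained from a map \<open>S : K \<rightarrow> \<Omega>'\<^sub>K\<close> vanishing on \<open>k\<close> by means of the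
  identification \<open>d : K' \<rightarrow> \<Omega>'\<^sub>K\<close>.
\<close>

definition endo_K' ::
  "('K \<Rightarrow> 'k::field fls) \<Rightarrow> ('K \<Rightarrow> 'v) \<Rightarrow> ('K \<Rightarrow> 'k fls) \<Rightarrow> 'v \<Rightarrow> 'v" where
  "endo_K' \<phi> q S x = inv (diff_K' \<phi> q) (factor q S x)"

definition S'_op :: "('K \<Rightarrow> 'k::field fls) \<Rightarrow> ('K \<Rightarrow> 'v) \<Rightarrow> 'k fls fls \<Rightarrow> 'v \<Rightarrow> 'v" where
  "S'_op \<phi> q \<eta> = endo_K' \<phi> q (S_op \<phi> \<eta>)"

definition L_space ::
  "('K \<Rightarrow> 'k::field fls) \<Rightarrow> ('K \<Rightarrow> 'v::ab_group_add) \<Rightarrow> 'k fls fls \<Rightarrow> 'v set" where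
  "L_space \<phi> q \<eta> = range (\<lambda>x. - S'_op \<phi> q \<eta> x)"

definition Pi_op :: "('K \<Rightarrow> 'k::field fls) \<Rightarrow> ('K \<Rightarrow> 'v) \<Rightarrow> 'k fls fls \<Rightarrow> 'v \<Rightarrow> 'v" where
  "Pi_op \<phi> q \<eta> = endo_K' \<phi> q (\<lambda>f. R_op \<phi> \<eta> f + S_op \<phi> \<eta> f)"

definition rho :: "('K \<Rightarrow> 'k::field fls) \<Rightarrow> ('K \<Rightarrow> 'v::ab_group_add) \<Rightarrow> 'k fls fls \<Rightarrow> 'v \<Rightarrow> 'v" where
  "rho \<phi> q \<xi> x = x + endo_K' \<phi> q (\<lambda>f. Res1 (pullback1 (\<phi> f) * \<xi>)) x"


section \<open>Torsors\<close>

text \<open>The acting group is a subgroup \<open>G\<close> of an additive group.\<close>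

definition torsor :: "'g::ab_group_add set \<Rightarrow> ('g \<Rightarrow> 'x \<Rightarrow> 'x) \<Rightarrow> 'x set \<Rightarrow> bool" where
  "torsor G act X \<longleftrightarrow>
     (0 \<in> G \<and> (\<forall>g\<in>G. \<forall>h\<in>G. g + h \<in> G) \<and> (\<forall>g\<in>G. - g \<in> G)) \<and>
     (\<forall>g\<in>G. \<forall>x\<in>X. act g x \<in> X) \<and>
     (\<forall>x\<in>X. act 0 x = x) \<and>
     (\<forall>g\<in>G. \<forall>h\<in>G. \<forall>x\<in>X. act (g + h) x = act g (act h x)) \<and>
     X \<noteq> {} \<and> (\<forall>x\<in>X. \<forall>y\<in>X. \<exists>!g. g \<in> G \<and> act g x = y)"

definition torsor_iso ::
  "'g::ab_group_add set \<Rightarrow> ('g \<Rightarrow> 'x \<Rightarrow> 'x) \<Rightarrow> 'x set \<Rightarrow> ('g \<Rightarrow> 'y \<Rightarrow> 'y) \<Rightarrow> 'y set \<Rightarrow> ('x \<Rightarrow> 'y) \<Rightarrow> bool" where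
  "torsor_iso G actX X actY Y F \<longleftrightarrow>
     torsor G actX X \<and> torsor G actY Y \<and> bij_betw F X Y \<and>
     (\<forall>g\<in>G. \<forall>x\<in>X. F (actX g x) = actY g (F x))"

end

(* The pole of a symmetric bidifferential with biresidue 1 is exactly (t1 - t2)^(-2): antisymmetry kills the
   next polar coefficient. Hence eta = (t1 - t2)^(-2) + xi with xi symmetric and regular, the Taylor expansion
   of f(t1) at t2 gives Res_(1->2), and S_eta maps t^(-n-1) to -d(t^(-n-1)) + xi_n, where xi_n(t2) is the
   coefficient of t1^n in xi. These operators S are the linear ones with S = 0 on O and S + d mapping K to Omega, and
   <d^(-1) S t^(-m-1), d^(-1) S t^(-n-1)> = xi_(m,n) - xi_(n,m), so the symmetry of xi says that the image is
   isotropic. An isotropic supplement of a Lagrangian subspace is Lagrangian; conversely, the projection along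
   m' onto a Lagrangian supplement is -d^(-1) S for an operator S of this form, which determines xi. *)

theory Submission
  imports Defs
begin

section \<open>The expansion in a uniformizer\<close>

text \<open>The ambient field of bidifferentials contains \<open>inverse (t1 - t2)\<close>, so
  divisibility by \<open>t1 - t2\<close> has content only inside \<open>K2\<close>. There the
  coefficients are bounded below in both indices, and each division argument follows an antidiagonal
  i + j = const until it leaves the support. The polar coefficient b next to the leading one dies
  because the involution negates \<open>t1 - t2\<close> but preserves restriction to the diagonal;
  hence 2b = 0. Bidifferentials and supplements meet in \<open>lagrangian_operator\<close>, which
  mentions neither of them nor a model of K'. Idempotence of -d^(-1) S follows from its non-isotropy
  clauses: if dA = S F, then d(A + F) is regular, so A + F is regular and S (A + F) = 0. Supplements
  are studied for a linear map \<open>Q\<close> on k((t)) with kernel the constants, inside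
  \<open>range Q\<close>. For \<open>Q\<close> the quotient map this yields the claims about K', for
  \<open>Q = fls_deriv\<close> the one about Omega'_K.\<close>

context complete_dv_algebra
begin

lemma iota_0 [simp]: "\<iota> 0 = 0"
  using iota_add[of 0 0] by (metis add.right_neutral add_left_cancel)

lemma iota_minus: "\<iota> (- a) = - \<iota> a"
  using iota_add[of a "- a"] by (simp add: eq_neg_iff_add_eq_0 add.commute)

lemma iota_unit: "c \<noteq> 0 \<Longrightarrow> \<iota> c dvd 1"
  using iota_mult[of c "inverse c"] dvd_triv_left[of "\<iota> c" "\<iota> (inverse c)"] by (simp add: iota_one)

definition truncation :: "'o \<Rightarrow> nat \<Rightarrow> 'k fps \<Rightarrow> 'o" where
  "truncation t n p = (\<Sum>i<n. \<iota> (fps_nth p i) * t ^ i)"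

lemma truncation_0 [simp]: "truncation t 0 p = 0"
  by (simp add: truncation_def)

lemma truncation_Suc: "truncation t (Suc n) p = \<iota> (fps_nth p 0) + t * truncation t n (fps_shift 1 p)"
  unfolding truncation_def
  by (subst sum.lessThan_Suc_shift) (simp add: sum_distrib_left mult_ac)

lemma truncation_Suc': "truncation t (Suc n) p = truncation t n p + \<iota> (fps_nth p n) * t ^ n"
  by (simp add: truncation_def)

lemma truncation_add: "truncation t n (p + q) = truncation t n p + truncation t n q"
  by (simp add: truncation_def iota_add algebra_simps sum.distrib)

lemma truncation_minus: "truncation t n (- p) = - truncation t n p"
  by (simp add: truncation_def iota_minus sum_negf)

lemma truncation_scale: "truncation t n (fps_const c * p) = \<iota> c * truncation t n p"
  by (simp add: truncation_def iota_mult sum_distrib_left mult_ac)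

lemma truncation_le: "n \<le> m \<Longrightarrow> t ^ n dvd truncation t m p - truncation t n p"
proof (induction m)
  case (Suc m)
  show ?case
  proof (cases "n \<le> m")
    case True
    then have "t ^ n dvd (truncation t m p - truncation t n p) + \<iota> (fps_nth p m) * t ^ m"
      using Suc le_imp_power_dvd by (intro dvd_add dvd_mult) auto
    then show ?thesis by (simp add: truncation_Suc' algebra_simps)
  qed (use Suc in \<open>simp add: le_Suc_eq\<close>)
qed simp

text \<open>Split off the constant coefficient, p = p_0 + X p'. The factor \<open>t\<close> coming
  from X raises the modulus from \<open>t ^ n\<close> to \<open>t ^ Suc n\<close>, which is why the
  induction varies \<open>p\<close>.\<close>

lemma truncation_mult: "t ^ n dvd truncation t n p * truncation t n q - truncation t n (p * q)"
proof (induction n arbitrary: p)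
  case (Suc n)
  define p' where "p' = fps_shift 1 p"
  have p: "p = fps_const (fps_nth p 0) + fps_X * p'"
    unfolding p'_def using fps_shift_times_fps_X[of "p - fps_const (fps_nth p 0)"]
    by (intro fps_ext) simp
  have Xt: "truncation t (Suc n) (fps_X * r) = t * truncation t n r" for r
  proof -
    have "fps_shift 1 (fps_X * r) = r" by (rule fps_ext) simp
    then show ?thesis by (simp add: truncation_Suc)
  qed
  have "truncation t (Suc n) (p * q)
      = \<iota> (fps_nth p 0) * truncation t (Suc n) q + t * truncation t n (p' * q)"
    by (subst p) (simp only: distrib_right truncation_add truncation_scale mult.assoc Xt)
  \<comment> \<open>The factor \<open>q\<close> is truncated at \<open>Suc n\<close>, the induction
    hypothesis at \<open>n\<close>; the second summand corrects this, and its bracket is the single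
    last term of \<open>q\<close>.\<close>
  then have "truncation t (Suc n) p * truncation t (Suc n) q - truncation t (Suc n) (p * q)
      = t * (truncation t n p' * truncation t n q - truncation t n (p' * q))
        + t * (truncation t n p' * (truncation t (Suc n) q - truncation t n q))"
    by (simp add: truncation_Suc[of t n p] p'_def algebra_simps)
  moreover have "t ^ Suc n dvd \<dots>"
    using Suc[of p'] truncation_le[of n "Suc n" t q]
    unfolding power_Suc by (intro dvd_add mult_dvd_mono dvd_mult) auto
  ultimately show ?case by simp
qed simp

text \<open>The relation under the definite description in \<open>power_series_expansion\<close>.
  Compatibility with sums and products is proved for the relation and passes to the function through
  \<open>pse_eq_iff\<close>, once existence and uniqueness are available.\<close>

definition expands :: "'o \<Rightarrow> 'o \<Rightarrow> 'k fps \<Rightarrow> bool" where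
  "expands t x p \<longleftrightarrow> (\<forall>n. t ^ n dvd x - truncation t n p)"

lemma expands_add: "expands t x p \<Longrightarrow> expands t y q \<Longrightarrow> expands t (x + y) (p + q)"
  unfolding expands_def truncation_add
  by (metis add_diff_add dvd_add)

lemma expands_mult:
  assumes "expands t x p" "expands t y q"
  shows "expands t (x * y) (p * q)"
  unfolding expands_def
proof
  fix n
  have *: "x * y - truncation t n (p * q) = (x - truncation t n p) * y + truncation t n p * (y - truncation t n q)
       + (truncation t n p * truncation t n q - truncation t n (p * q))"
    by (simp add: algebra_simps)
  have "t ^ n dvd (x - truncation t n p) * y + truncation t n p * (y - truncation t n q)
       + (truncation t n p * truncation t n q - truncation t n (p * q))"
    using assms truncation_mult[of t n p q] unfolding expands_def
    by (intro dvd_add dvd_mult dvd_mult2) auto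
  then show "t ^ n dvd x * y - truncation t n (p * q)"
    by (simp only: *)
qed

lemma expands_const: "expands t (\<iota> c) (fps_const c)"
  unfolding expands_def
proof
  fix n show "t ^ n dvd \<iota> c - truncation t n (fps_const c)"
    by (cases n) (simp_all add: truncation_Suc, simp add: truncation_def)
qed

end

section \<open>Bijectivity of the expansion in a fixed uniformizer\<close>

locale uniformized_dv_algebra = complete_dv_algebra \<iota> for \<iota> :: "'k::field_char_0 \<Rightarrow> 'o::idom" +
  fixes t :: 'o
  assumes irreducible_t: "irreducible t"
begin

text \<open>The axiom provides some uniformizer \<open>p\<close>, not the given \<open>t\<close>. In
  \<open>t = u * p ^ n\<close> with n > 0, irreducibility of \<open>t\<close> makes the cofactor of
  one \<open>p\<close> a unit, because \<open>p\<close> is not one; so \<open>p\<close> and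
  \<open>t\<close> are associates.\<close>

lemma unit_times_power:
  assumes "x \<noteq> 0"
  obtains u n where "u dvd 1" "x = u * t ^ n"
proof -
  obtain p :: 'o where p: "irreducible p" "\<And>x. x \<noteq> 0 \<Longrightarrow> \<exists>u n. u dvd 1 \<and> x = u * p ^ n"
    using discrete_valuation_ring by blast
  have "t \<noteq> 0" "\<not> t dvd 1" using irreducible_t by (auto simp: irreducible_def)
  obtain u n where u: "u dvd 1" "t = u * p ^ n" using p(2) \<open>t \<noteq> 0\<close> by blast
  have "n \<noteq> 0" using u \<open>\<not> t dvd 1\<close> by (cases n) auto
  then obtain m where m: "n = Suc m" by (cases n) auto
  have "t = (u * p ^ m) * p" using u m by (simp add: mult_ac)
  then have "u * p ^ m dvd 1" using irreducibleD[OF irreducible_t, of "u * p ^ m" p] p(1) by (auto simp: irreducible_def)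
  then obtain w where w: "1 = (u * p ^ m) * w" by (auto simp: dvd_def)
  then have pt: "p = w * t"
  proof -
    have "p = ((u * p ^ m) * w) * p" by (simp flip: w)
    also have "\<dots> = w * ((u * p ^ m) * p)" by (simp add: mult_ac)
    finally show ?thesis by (simp flip: \<open>t = (u * p ^ m) * p\<close>)
  qed
  have "w dvd 1" using w by (metis dvd_triv_right)
  obtain v k where v: "v dvd 1" "x = v * p ^ k" using p(2) assms by blast
  have "w ^ k dvd 1" using \<open>w dvd 1\<close> using dvd_power_same[of w 1 k] by simp
  then show ?thesis using that[of "v * w ^ k" k] v pt mult_dvd_mono[of v 1 "w ^ k" 1] by (simp add: power_mult_distrib mult_ac)
qed

lemma t_nonzero: "t \<noteq> 0"
  using irreducible_t by auto

lemma t_not_unit: "\<not> t dvd 1"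
  using irreducible_t by (auto simp: irreducible_def)

lemma max_ideal_iff: "x \<in> max_ideal \<longleftrightarrow> t dvd x"
proof
  assume x: "x \<in> max_ideal"
  show "t dvd x"
  proof (cases "x = 0")
    case False
    then obtain u n where u: "u dvd 1" "x = u * t ^ n" by (rule unit_times_power)
    with x have "n \<noteq> 0" by (cases n) (auto simp: max_ideal_def)
    then show ?thesis using u(2) by (cases n) auto
  qed simp
next
  assume "t dvd x"
  then show "x \<in> max_ideal"
    using t_not_unit dvd_trans[of t x 1] by (auto simp: max_ideal_def)
qed

lemma separated:
  assumes "\<And>n. t ^ n dvd x"
  shows "x = 0"
proof (rule ccontr)
  assume "x \<noteq> 0"
  then obtain u n where u: "u dvd 1" "x = u * t ^ n" by (rule unit_times_power)
  have "t * t ^ n dvd u * t ^ n" using assms[of "Suc n"] u by simp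
  then have "t dvd u" using t_nonzero by (subst (asm) dvd_mult_cancel_right) simp
  then show False using u(1) t_not_unit dvd_trans[of t u 1] by simp
qed

text \<open>Digit extraction: the residue field supplies the constant term, the remainder is
  divisible by \<open>t\<close>, and the quotient is treated in the same way.\<close>

lemma expands_ex: "\<exists>p. expands t x p"
proof -
  have "\<exists>c y. x = \<iota> c + t * y" for x
  proof -
    obtain c where "t dvd x - \<iota> c" using residue_field[of x] unfolding max_ideal_iff by blast
    then obtain y where "x - \<iota> c = t * y" by (auto simp: dvd_def)
    then have "x = \<iota> c + t * y" by (simp add: algebra_simps)
    then show ?thesis by blast
  qed
  then obtain c y where cy: "\<And>x. x = \<iota> (c x) + t * y x" by metis
  \<comment> \<open>Here \<open>y\<close> is the quotient by \<open>t\<close> after removal of the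
    residue, so the i-th digit is the residue of the i-th iterate of \<open>y\<close>.\<close>
  define p where "p x = Abs_fps (\<lambda>i. c ((y ^^ i) x))" for x
  have "t ^ n dvd x - truncation t n (p x)" for n x
  proof (induction n arbitrary: x)
    case (Suc n)
    have "fps_shift 1 (p x) = p (y x)"
      by (rule fps_ext) (simp add: p_def funpow_swap1)
    then have "x - truncation t (Suc n) (p x) = t * (y x - truncation t n (p (y x)))"
      by (subst cy[of x]) (simp add: truncation_Suc p_def algebra_simps)
    then show ?case using Suc[of "y x"] by simp
  qed simp
  then show ?thesis unfolding expands_def by blast
qed

text \<open>The truncation just past the lowest nonzero coefficient is that coefficient times
  \<open>t ^ n\<close>; a nonzero constant is a unit, so \<open>t ^ Suc n\<close> cannot divide
  it.\<close>

lemma truncation_dvd_zero: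
  assumes "\<And>n. t ^ n dvd truncation t n p"
  shows "p = 0"
proof (rule ccontr)
  assume "p \<noteq> 0"
  define n where "n = subdegree p"
  have z: "truncation t n p = 0"
    unfolding truncation_def
  proof (rule sum.neutral, rule ballI)
    fix i assume "i \<in> {..<n}"
    then have "fps_nth p i = 0" unfolding n_def by (intro nth_less_subdegree_zero) simp
    then show "\<iota> (fps_nth p i) * t ^ i = 0" by simp
  qed
  have "truncation t (Suc n) p = \<iota> (fps_nth p n) * t ^ n"
    unfolding truncation_Suc' z by simp
  then have "t * t ^ n dvd \<iota> (fps_nth p n) * t ^ n"
    using assms[of "Suc n"] by (simp only: power_Suc)
  then have "t dvd \<iota> (fps_nth p n)" using t_nonzero by (subst (asm) dvd_mult_cancel_right) simp
  moreover have "\<iota> (fps_nth p n) dvd 1"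
    using \<open>p \<noteq> 0\<close> by (intro iota_unit) (simp add: n_def)
  ultimately show False
    using t_not_unit dvd_trans[of t "\<iota> (fps_nth p n)" 1] by simp
qed

lemma expands_unique_series:
  assumes "expands t x p" "expands t x q"
  shows "p = q"
proof -
  have "t ^ n dvd truncation t n (p + - q)" for n
  proof -
    have "truncation t n (p + - q) = (x - truncation t n q) - (x - truncation t n p)"
      unfolding truncation_add truncation_minus by (simp add: algebra_simps)
    then show ?thesis using assms dvd_diff[of "t ^ n" "x - truncation t n q" "x - truncation t n p"]
      by (simp add: expands_def)
  qed
  then have "p + - q = 0" by (rule truncation_dvd_zero)
  then show ?thesis by simp
qed

lemma expands_unique:
  assumes "expands t x p" "expands t y p"
  shows "x = y"
proof -
  have "t ^ n dvd x - y" for n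
    using dvd_diff[of "t ^ n" "x - truncation t n p" "y - truncation t n p"] assms
    by (simp add: expands_def)
  then show ?thesis using separated[of "x - y"] by simp
qed

text \<open>Completeness enters here: the partial sums are Cauchy, and their limit has the
  prescribed expansion.\<close>

lemma expands_surj: "\<exists>x. expands t x p"
proof -
  have "\<exists>N. \<forall>i\<ge>N. \<forall>j\<ge>N. t ^ n dvd truncation t i p - truncation t j p" for n
  proof (intro exI[of _ n] allI impI)
    fix i j assume "n \<le> i" "n \<le> j"
    then show "t ^ n dvd truncation t i p - truncation t j p"
      using dvd_diff[OF truncation_le[of n i t p] truncation_le[of n j t p]] by simp
  qed
  from complete[OF irreducible_t, of "\<lambda>i. truncation t i p", OF this]
  obtain x where x: "\<And>n. \<exists>N. \<forall>i\<ge>N. t ^ n dvd truncation t i p - x" by blast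
  have "t ^ n dvd x - truncation t n p" for n
  proof -
    obtain N where N: "\<And>i. i \<ge> N \<Longrightarrow> t ^ n dvd truncation t i p - x" using x by blast
    show ?thesis
      using dvd_diff[OF truncation_le[of n "max n N" t p] N[of "max n N"]] by simp
  qed
  then show ?thesis unfolding expands_def by blast
qed

abbreviation pse :: "'o \<Rightarrow> 'k fps" where
  "pse \<equiv> power_series_expansion \<iota> t"

lemma pse_eq_iff: "pse x = p \<longleftrightarrow> expands t x p"
proof -
  have "power_series_expansion \<iota> t x = (THE p. expands t x p)"
    by (simp add: power_series_expansion_def expands_def truncation_def)
  then show ?thesis using expands_ex[of x] expands_unique_series by (metis the_equality)
qed

lemma expands_pse: "expands t x (pse x)"
  using pse_eq_iff by blast

lemma pse_add: "pse (x + y) = pse x + pse y"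
  by (simp add: pse_eq_iff expands_add expands_pse)

lemma pse_mult: "pse (x * y) = pse x * pse y"
  by (simp add: pse_eq_iff expands_mult expands_pse)

lemma pse_iota: "pse (\<iota> c) = fps_const c"
  by (simp add: pse_eq_iff expands_const)

lemma pse_0 [simp]: "pse 0 = 0"
  using pse_iota[of 0] by simp

lemma pse_1 [simp]: "pse 1 = 1"
  using pse_iota[of 1] by (simp add: iota_one)

lemma pse_eq_0_iff [simp]: "pse x = 0 \<longleftrightarrow> x = 0"
  using expands_unique[of x "pse x" 0] expands_pse[of x] expands_pse[of 0] by auto

lemma surj_pse: "surj pse"
proof (rule surjI)
  show "pse (SOME x. expands t x p) = p" for p
    unfolding pse_eq_iff by (rule someI_ex) (rule expands_surj)
qed

section \<open>The Laurent expansion of the fraction field\<close>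

abbreviation lexp :: "'o fract \<Rightarrow> 'k fls" where
  "lexp \<equiv> laurent_expansion \<iota> t"

lemma lexp_Fract:
  assumes "b \<noteq> 0"
  shows "lexp (Fract a b) = fps_to_fls (pse a) / fps_to_fls (pse b)"
  unfolding laurent_expansion_def
proof (rule the_equality)
  fix F
  assume "\<exists>a' b'. b' \<noteq> 0 \<and> Fract a b = Fract a' b' \<and> F = fps_to_fls (pse a') / fps_to_fls (pse b')"
  then obtain a' b' where ab: "b' \<noteq> 0" "Fract a b = Fract a' b'"
    "F = fps_to_fls (pse a') / fps_to_fls (pse b')" by blast
  have "a * b' = a' * b" using ab(1,2) assms by (simp add: eq_fract)
  then have "pse a * pse b' = pse a' * pse b" by (metis pse_mult)
  then have "fps_to_fls (pse a) * fps_to_fls (pse b') = fps_to_fls (pse a') * fps_to_fls (pse b)"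
    by (simp flip: fls_times_fps_to_fls)
  then show "F = fps_to_fls (pse a) / fps_to_fls (pse b)"
    using ab(1,3) assms by (simp add: frac_eq_eq)
qed (use assms in blast)

lemma lexp_to_fract: "lexp (to_fract x) = fps_to_fls (pse x)"
  by (simp add: to_fract_def lexp_Fract)

lemma lexp_add: "lexp (f + g) = lexp f + lexp g"
  by (cases f, cases g)
    (simp add: lexp_Fract pse_add pse_mult fls_times_fps_to_fls add_frac_eq mult.commute)

lemma lexp_mult: "lexp (f * g) = lexp f * lexp g"
  by (cases f, cases g) (simp add: lexp_Fract pse_mult fls_times_fps_to_fls)

lemma lexp_scale: "lexp (scale_K \<iota> c f) = fls_const c * lexp f"
  by (simp add: scale_K_def lexp_mult lexp_to_fract pse_iota)

lemma lexp_eq_0_iff: "lexp f = 0 \<longleftrightarrow> f = 0"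
  by (cases f) (auto simp add: lexp_Fract Zero_fract_def eq_fract)

lemma bij_lexp: "bij lexp"
proof (rule bijI)
  show "inj lexp"
  proof (rule injI)
    fix f g assume "lexp f = lexp g"
    moreover have "lexp f = lexp (f - g) + lexp g" by (simp flip: lexp_add)
    ultimately show "f = g" by (simp add: lexp_eq_0_iff)
  qed
  show "surj lexp"
    unfolding surj_def
  proof
    fix F :: "'k fls"
    obtain x where x: "pse x = fls_base_factor_to_fps F" using surj_pse by (metis surjD)
    \<comment> \<open>An element expanding to the variable; its powers, and their inverses in the
      fraction field, realize all \<open>fls_X_intpow n\<close>.\<close>
    obtain b where b: "pse b = fps_X" using surj_pse by (metis surjD)
    have b0: "b \<noteq> 0" using b by auto
    have F: "F = fps_to_fls (pse x) * fls_X_intpow (fls_subdegree F)"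
      unfolding x using fls_conv_base_factor_to_fps_shift_subdegree[of F]
      by (simp add: fls_X_intpow_times_conv_shift)
    have "\<exists>g. lexp g = fls_X_intpow n" for n
    proof (cases "n \<ge> 0")
      case True
      then have "lexp (to_fract b ^ nat n) = fls_X_intpow n"
      proof -
        have "lexp (to_fract b ^ m) = fls_X ^ m" for m
          by (induction m) (simp_all add: lexp_mult lexp_to_fract b One_fract_def lexp_Fract)
        then show ?thesis using True by (simp add: fls_X_power_conv_shift_1)
      qed
      then show ?thesis by blast
    next
      case False
      have "lexp (Fract 1 (b ^ m)) = inverse (fls_X ^ m)" for m
      proof -
        have "pse (b ^ m) = fps_X ^ m" by (induction m) (simp_all add: pse_mult b)
        then show ?thesis using b0
          by (simp add: lexp_Fract fps_to_fls_power divide_inverse)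
      qed
      from this[of "nat (- n)"] False have "lexp (Fract 1 (b ^ nat (- n))) = fls_X_intpow n"
        using fls_inverse_X_intpow[of "- n"] by (simp add: fls_X_power_conv_shift_1)
      then show ?thesis by blast
    qed
    then obtain g where "lexp g = fls_X_intpow (fls_subdegree F)" by blast
    with F have "F = lexp (to_fract x * g)" by (simp add: lexp_mult lexp_to_fract)
    then show "\<exists>f. F = lexp f" by blast
  qed
qed

text \<open>\<open>Omega\<close> was introduced for differentials h dt with h regular; as a set of
  series it is k[[t]], so below it also stands for the image of O in k((t)).\<close>

lemma lexp_image_range: "lexp ` range to_fract = Omega"
proof -
  have "lexp ` range to_fract = fps_to_fls ` range pse"
    by (auto simp: lexp_to_fract image_image)
  then show ?thesis by (simp add: surj_pse Omega_def)
qed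

end

section \<open>Expansions along the diagonal\<close>

definition diag_var :: "'k::field fls fls" where
  "diag_var = t1 - t2"

lemma diag_power_eq: "diag_power n M = (\<lambda>G. diag_var powi n * G) ` M"
  by (simp add: diag_power_def diag_var_def)

lemma bicoeff_eqI: "(\<And>i j. bicoeff F i j = bicoeff G i j) \<Longrightarrow> F = G"
  unfolding bicoeff_def by (intro fls_eqI) blast

lemma bicoeff_add [simp]: "bicoeff (F + G) i j = bicoeff F i j + bicoeff G i j"
  by (simp add: bicoeff_def)

lemma bicoeff_diff [simp]: "bicoeff (F - G) i j = bicoeff F i j - bicoeff G i j"
  by (simp add: bicoeff_def)

lemma bicoeff_uminus [simp]: "bicoeff (- F) i j = - bicoeff F i j"
  by (simp add: bicoeff_def)

lemma bicoeff_0 [simp]: "bicoeff 0 i j = 0"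
  by (simp add: bicoeff_def)

lemma bicoeff_1: "bicoeff 1 i j = (if i = 0 \<and> j = 0 then 1 else 0)"
  by (simp add: bicoeff_def)

lemma bicoeff_diag_var_mult: "bicoeff (diag_var * F) i j = bicoeff F (i - 1) j - bicoeff F i (j - 1)"
  by (simp add: bicoeff_def diag_var_def t1_def t2_def left_diff_distrib fls_X_times_conv_shift)

lemma diag_var_nonzero [simp]: "(diag_var :: 'k::field fls fls) \<noteq> 0"
proof
  assume "(diag_var :: 'k fls fls) = 0"
  then have "bicoeff (diag_var * 1 :: 'k fls fls) 1 0 = 0" by simp
  then show False unfolding bicoeff_diag_var_mult by (simp add: bicoeff_1)
qed

lemma pullback1_nth [simp]: "fls_nth (pullback1 f) i = fls_const (fls_nth f i)"
proof -
  obtain N where "\<forall>n<N. fls_nth f n = 0" by (elim fls_nth_vanishes_belowE)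
  then show ?thesis unfolding pullback1_def by (intro nth_Abs_fls_lower_bound[of N]) auto
qed

lemma bicoeff_pullback1: "bicoeff (pullback1 f) i j = (if j = 0 then fls_nth f i else 0)"
  by (simp add: bicoeff_def)

lemma bicoeff_pullback2: "bicoeff (pullback2 f) i j = (if i = 0 then fls_nth f j else 0)"
  by (simp add: bicoeff_def pullback2_def)

lemma pullback2_0 [simp]: "pullback2 0 = 0"
  by (simp add: pullback2_def)

lemma pullback2_1 [simp]: "pullback2 1 = 1"
  by (simp add: pullback2_def)

lemma pullback2_diff: "pullback2 (f - g) = pullback2 f - pullback2 g"
  by (simp add: pullback2_def fls_minus_const)

lemma pullback1_add: "pullback1 (f + g) = pullback1 f + pullback1 g"
  by (rule bicoeff_eqI) (simp add: bicoeff_pullback1)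

lemma pullback1_scale: "pullback1 (fls_const c * f) = fls_const (fls_const c) * pullback1 f"
  by (rule fls_eqI) simp

lemma pullback1_X_intpow: "pullback1 (fls_X_intpow n) = fls_X_intpow n"
  by (rule fls_eqI) simp

text \<open>Bounds below in both indices make each row, and the sequence of rows, a legitimate
  Laurent series; so elements of \<open>K2\<close> may be given by their arrays of
  coefficients.\<close>

lemma bicoeff_ex:
  assumes "\<And>i j. min i j < N \<Longrightarrow> g i j = 0"
  obtains F where "\<And>i j. bicoeff F i j = g i j"
proof
  fix i j
  have *: "fls_nth (Abs_fls (g i)) j = g i j" for i j
    using assms by (intro nth_Abs_fls_lower_bound[of N]) auto
  have "fls_nth (Abs_fls (\<lambda>i. Abs_fls (g i))) i = Abs_fls (g i)"
  proof (rule nth_Abs_fls_lower_bound[of N], intro allI impI)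
    fix i assume "i < N" then show "Abs_fls (g i) = 0" using assms by (intro fls_eqI) (simp add: *)
  qed
  then show "bicoeff (Abs_fls (\<lambda>i. Abs_fls (g i))) i j = g i j"
    by (simp add: bicoeff_def *)
qed

lemma K2_I: "(\<And>i j. min i j < N \<Longrightarrow> bicoeff F i j = 0) \<Longrightarrow> F \<in> K2"
  unfolding K2_def by blast

lemma K2_E:
  assumes "F \<in> K2"
  obtains N where "\<And>i j. min i j < N \<Longrightarrow> bicoeff F i j = 0"
  using assms unfolding K2_def by blast

lemma O2_subset_K2: "F \<in> O2 \<Longrightarrow> F \<in> K2"
  by (auto simp: O2_def K2_def)

lemma K2_uminus: "F \<in> K2 \<Longrightarrow> - F \<in> K2"
  by (auto simp: K2_def)

lemma K2_add:
  assumes "F \<in> K2" "G \<in> K2"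
  shows "F + G \<in> K2"
proof -
  obtain M N where "\<And>i j. min i j < M \<Longrightarrow> bicoeff F i j = 0" "\<And>i j. min i j < N \<Longrightarrow> bicoeff G i j = 0"
    using assms by (metis K2_E)
  then show ?thesis by (intro K2_I[of "min M N"]) simp
qed

lemma K2_diff: "F \<in> K2 \<Longrightarrow> G \<in> K2 \<Longrightarrow> F - G \<in> K2"
  using K2_add[of F "- G"] K2_uminus[of G] by simp

lemma fls_mult_nth_eq_0:
  fixes f g :: "'a::semiring_0 fls"
  assumes "\<And>i. i < a \<Longrightarrow> fls_nth f i = 0" "\<And>i. i < b \<Longrightarrow> fls_nth g i = 0" "n < a + b"
  shows "fls_nth (f * g) n = 0"
proof (cases "f = 0 \<or> g = 0")
  case False
  then have "a \<le> fls_subdegree f" "b \<le> fls_subdegree g"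
    using assms(1,2) by (meson fls_subdegree_geI)+
  then show ?thesis using assms(3) by (intro fls_times_nth_eq0) linarith
qed auto

lemma K2_mult:
  assumes "F \<in> K2" "G \<in> K2"
  shows "F * G \<in> K2"
proof -
  obtain M N where M: "\<And>i j. min i j < M \<Longrightarrow> bicoeff F i j = 0"
    and N: "\<And>i j. min i j < N \<Longrightarrow> bicoeff G i j = 0"
    using assms by (metis K2_E)
  have z: "fls_nth F i = 0" if "i < M" for i
    using M[of i] that by (intro fls_eqI) (simp add: bicoeff_def)
  have z': "fls_nth G i = 0" if "i < N" for i
    using N[of i] that by (intro fls_eqI) (simp add: bicoeff_def)
  show ?thesis
  proof (rule K2_I)
    fix i j assume "min i j < M + N"
    then consider "i < M + N" | "j < M + N" by linarith
    then show "bicoeff (F * G) i j = 0"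
    proof cases
      case 1
      then show ?thesis unfolding bicoeff_def using fls_mult_nth_eq_0[OF z z', of M N i] by simp
    next
      case 2
      have "fls_nth (fls_nth F k * fls_nth G l) j = 0" for k l
        using 2 M N by (intro fls_mult_nth_eq_0[of M _ N]) (auto simp: bicoeff_def)
      then show ?thesis unfolding bicoeff_def fls_times_nth(1) fls_nth_sum by simp
    qed
  qed
qed

lemma K2_diag_var [simp]: "diag_var \<in> K2"
proof (rule K2_I)
  fix i j :: int assume "min i j < 0"
  have "bicoeff (diag_var * 1 :: 'a fls fls) i j = 0"
    unfolding bicoeff_diag_var_mult using \<open>min i j < 0\<close> by (auto simp: bicoeff_1)
  then show "bicoeff (diag_var :: 'a fls fls) i j = 0" by simp
qed

lemma K2_1 [simp]: "1 \<in> K2"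
  by (rule K2_I[of 0]) (auto simp: bicoeff_1)

lemma K2_diag_var_power [simp]: "diag_var ^ n \<in> K2"
  by (induction n) (simp_all add: K2_mult)

lemma K2_pullback1 [simp]: "pullback1 f \<in> K2"
proof -
  obtain N where "\<forall>n<N. fls_nth f n = 0" by (elim fls_nth_vanishes_belowE)
  then show ?thesis by (intro K2_I[of "min N 0"]) (auto simp: bicoeff_pullback1)
qed

lemma K2_pullback2 [simp]: "pullback2 f \<in> K2"
proof -
  obtain N where "\<forall>n<N. fls_nth f n = 0" by (elim fls_nth_vanishes_belowE)
  then show ?thesis by (intro K2_I[of "min N 0"]) (auto simp: bicoeff_pullback2)
qed

section \<open>Division by \<open>t1 - t2\<close> inside \<open>K2\<close>\<close>

lemma diag_var_powi_Suc: "diag_var powi (n + 1) = diag_var powi n * diag_var"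
  by (rule power_int_add_1) (simp add: diag_var_nonzero)

text \<open>A vanishing coefficient of \<open>diag_var * H\<close> equates two neighbours of
  \<open>H\<close> on an antidiagonal. From \<open>i < 0\<close> one walks towards smaller first
  index until the bound of \<open>K2\<close> makes the coefficient zero.\<close>

lemma bicoeff_eq_0_left:
  assumes "H \<in> K2" "\<And>k l. k < 0 \<Longrightarrow> bicoeff (diag_var * H) k l = 0" "i < 0"
  shows "bicoeff H i j = 0"
proof -
  obtain N where N: "\<And>i j. min i j < N \<Longrightarrow> bicoeff H i j = 0" using assms(1) unfolding K2_def by blast
  have "bicoeff H i j = bicoeff H (i - int m) (j + int m)" for m
  proof (induction m)
    case (Suc m)
    have e: "i - int (Suc m) = i - int m - 1" "j + int (Suc m) = j + int m + 1" by simp_all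
    have "bicoeff (diag_var * H) (i - int m) (j + int m + 1) = 0"
      using assms(3) by (intro assms(2)) simp
    then show ?case unfolding e bicoeff_diag_var_mult Suc by (simp only: right_minus_eq add_diff_cancel_right')
  qed simp
  \<comment> \<open>Enough steps to push the first index below \<open>N\<close>; the cut-off of
    \<open>nat\<close> at zero covers an \<open>i\<close> already below it.\<close>
  then have "bicoeff H i j = bicoeff H (i - int (nat (i - N + 1))) (j + int (nat (i - N + 1)))" .
  also have "\<dots> = 0" by (intro N) linarith
  finally show ?thesis .
qed

text \<open>The walk towards smaller second index. What stops it is the bound of \<open>K2\<close>
  in that index: \<open>inverse diag_var\<close> satisfies the condition on the product, yet has
  nonzero coefficients with \<open>i \<ge> 0\<close>.\<close>

lemma bicoeff_eq_0_right:
  assumes "H \<in> K2" "\<And>k l. k > 0 \<Longrightarrow> l \<le> j \<Longrightarrow> bicoeff (diag_var * H) k l = 0" "i \<ge> 0"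
  shows "bicoeff H i j = 0"
proof -
  obtain N where N: "\<And>i j. min i j < N \<Longrightarrow> bicoeff H i j = 0" using assms(1) unfolding K2_def by blast
  have "bicoeff H i j = bicoeff H (i + int m) (j - int m)" for m
  proof (induction m)
    case (Suc m)
    have e: "i + int (Suc m) = i + int m + 1" "j - int (Suc m) = j - int m - 1" by simp_all
    have "bicoeff (diag_var * H) (i + int m + 1) (j - int m) = 0"
      using assms(3) by (intro assms(2)) simp_all
    then show ?case unfolding e bicoeff_diag_var_mult Suc by (simp only: right_minus_eq add_diff_cancel_right')
  qed simp
  then have "bicoeff H i j = bicoeff H (i + int (nat (j - N + 1))) (j - int (nat (j - N + 1)))" .
  also have "\<dots> = 0" by (intro N) linarith
  finally show ?thesis .
qed

text \<open>Coefficients with negative first index are killed by the walk to the left, those with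
  \<open>i \<ge> 0\<close> and \<open>j < 0\<close> by the walk to the right, which stays at second
  indices at most \<open>j\<close>.\<close>

lemma O2_of_diag_var_mult:
  assumes "H \<in> K2" "diag_var * H \<in> O2"
  shows "H \<in> O2"
proof -
  have z: "bicoeff (diag_var * H) k l = 0" if "min k l < 0" for k l
    using assms(2) that by (simp add: O2_def)
  have "bicoeff H i j = 0" if "min i j < 0" for i j
  proof (cases "i < 0")
    case True
    then show ?thesis using z by (intro bicoeff_eq_0_left[OF assms(1)]) auto
  next
    case False
    then show ?thesis using z that by (intro bicoeff_eq_0_right[OF assms(1)]) auto
  qed
  then show ?thesis by (simp add: O2_def)
qed

text \<open>Formally this is the substitution t1 = t2. The product has coefficients only at
  \<open>k = 0\<close>, which neither walk meets, so all of \<open>H\<close> vanishes.\<close>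

lemma pullback2_eq_diag_var_mult:
  assumes "pullback2 f = diag_var * H" "H \<in> K2"
  shows "f = 0"
proof -
  have e: "bicoeff (diag_var * H) k l = (if k = 0 then fls_nth f l else 0)" for k l
    by (simp flip: assms(1) add: bicoeff_pullback2)
  have "bicoeff H i j = 0" for i j
    using bicoeff_eq_0_left[OF assms(2)] bicoeff_eq_0_right[OF assms(2)] e by (cases "i < 0") auto
  then have "bicoeff (diag_var * H) 0 j = 0" for j
    by (simp add: bicoeff_diag_var_mult)
  then show ?thesis using e by (intro fls_eqI) simp
qed

text \<open>The series \<open>f\<close> below is the restriction of \<open>G\<close> to the diagonal.\<close>

lemma K2_decomposition:
  assumes "G \<in> K2"
  obtains f H where "H \<in> K2" "G = pullback2 f + diag_var * H"
proof -
  obtain N0 where N0: "\<And>i j. min i j < N0 \<Longrightarrow> bicoeff G i j = 0" using assms unfolding K2_def by blast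
  \<comment> \<open>Capping at 0 ensures that \<open>a < N\<close> forces \<open>a < 0\<close> and
    that \<open>2 * N \<le> N\<close>; both are used for the support of \<open>h\<close>.\<close>
  define N where "N = min N0 0"
  have N: "bicoeff G i j = 0" if "min i j < N" for i j using that N0 by (simp add: N_def)
  have N_le: "N \<le> 0" by (simp add: N_def)
  \<comment> \<open>The sum over the whole antidiagonal n: outside this range one of the two indices
    is below \<open>N\<close>.\<close>
  define f0 where "f0 n = (\<Sum>i\<in>{N..n - N}. bicoeff G i (n - i))" for n
  have f: "fls_nth (Abs_fls f0) n = f0 n" for n
    by (rule nth_Abs_fls_lower_bound[of "2 * N"]) (simp add: f0_def)
  \<comment> \<open>Division by \<open>t1 - t2\<close> amounts to summation along an antidiagonal
    from the left. The entry is minus the partial sum of \<open>G\<close> with its restriction to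
    the diagonal subtracted; the latter sits at first index 0, hence counts once
    \<open>a \<ge> 0\<close>.\<close>
  define h where "h a c = (if a \<ge> 0 then f0 (a + c + 1) else 0) - (\<Sum>i\<in>{N..a}. bicoeff G i (a + c + 1 - i))"
    for a c
  have h: "h a c = 0" if "min a c < 2 * N" for a c
  proof (cases "a < N")
    case True
    then show ?thesis using N_le by (simp add: h_def)
  next
    case False
    then have c: "c < 2 * N" using that N_le by linarith
    show ?thesis
    proof (cases "a \<ge> 0")
      case True
      \<comment> \<open>Beyond the index a + c + 1 - N, which is at most a, all terms vanish, so the
        partial sum is already the full one.\<close>
      have "(\<Sum>i\<in>{N..a}. bicoeff G i (a + c + 1 - i)) = f0 (a + c + 1)"
        unfolding f0_def using c N_le by (intro sum.mono_neutral_right) (auto intro!: N)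
      then show ?thesis using True by (simp add: h_def)
    next
      case False
      have "(\<Sum>i\<in>{N..a}. bicoeff G i (a + c + 1 - i)) = 0"
        using c False by (intro sum.neutral ballI N) auto
      then show ?thesis using False by (simp add: h_def)
    qed
  qed
  obtain H where H: "\<And>i j. bicoeff H i j = h i j" using bicoeff_ex[of "2 * N" h] h by blast
  have "H \<in> K2" using h by (intro K2_I[of "2 * N"]) (simp add: H)
  moreover have "G = pullback2 (Abs_fls f0) + diag_var * H"
  proof (rule bicoeff_eqI)
    fix i j
    have "(\<Sum>k\<in>{N..i}. bicoeff G k (i + j - k)) = (\<Sum>k\<in>{N..i - 1}. bicoeff G k (i + j - k)) + bicoeff G i j"
    proof (cases "i < N")
      case False
      then have "{N..i} = insert i {N..i - 1}" by auto
      then show ?thesis by (simp add: add.commute)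
    qed (simp add: N)
    then show "bicoeff G i j = bicoeff (pullback2 (Abs_fls f0) + diag_var * H) i j"
      unfolding bicoeff_add bicoeff_pullback2 bicoeff_diag_var_mult H h_def f
      by (cases "i = 0") (auto simp: algebra_simps)
  qed
  ultimately show ?thesis by (rule that)
qed

section \<open>Uniqueness and existence of expansions along the diagonal\<close>

lemma power_int_split:
  fixes x :: "'a::division_ring"
  assumes "x \<noteq> 0" "m \<le> n"
  shows "x powi n = x powi m * x ^ nat (n - m)"
  using assms power_int_add[of x m "n - m"] power_int_of_nat[of x "nat (n - m)"] by simp

lemma diag_power_antimono:
  assumes "m \<le> n" "F \<in> diag_power n K2"
  shows "F \<in> diag_power m K2"
proof -
  obtain G where G: "G \<in> K2" "F = diag_var powi n * G" using assms(2) by (auto simp: diag_power_eq)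
  have "F = diag_var powi m * (diag_var ^ nat (n - m) * G)"
    unfolding G(2) power_int_split[OF diag_var_nonzero assms(1)] by (rule mult.assoc)
  then show ?thesis using G(1) unfolding diag_power_eq by (blast intro: K2_mult K2_diag_var_power)
qed

lemma diag_power_diff:
  assumes "F \<in> diag_power n K2" "G \<in> diag_power n K2"
  shows "F - G \<in> diag_power n K2"
  using assms K2_diff by (fastforce simp: diag_power_eq simp flip: right_diff_distrib)

text \<open>The starting index is a parameter in place of the existential in
  \<open>is_diag_expansion\<close>; two expansions are compared after lowering both to the smaller
  start.\<close>

definition diag_expansion_from :: "int \<Rightarrow> 'k::field fls fls \<Rightarrow> (int \<Rightarrow> 'k fls) \<Rightarrow> bool" where
  "diag_expansion_from n0 F f \<longleftrightarrow> (\<forall>n<n0. f n = 0) \<and>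
     (\<forall>m. F - (\<Sum>n\<in>{n0..m}. diag_var powi n * pullback2 (f n)) \<in> diag_power (m + 1) K2)"

lemma is_diag_expansion_iff: "is_diag_expansion F f \<longleftrightarrow> (\<exists>n0. diag_expansion_from n0 F f)"
  by (simp add: is_diag_expansion_def diag_expansion_from_def diag_var_def)

lemma diag_expansion_from_antimono:
  assumes "n1 \<le> n0" "diag_expansion_from n0 F f"
  shows "diag_expansion_from n1 F f"
proof -
  have "(\<Sum>n\<in>{n1..m}. diag_var powi n * pullback2 (f n)) = (\<Sum>n\<in>{n0..m}. diag_var powi n * pullback2 (f n))" for m
    using assms by (intro sum.mono_neutral_right) (auto simp: diag_expansion_from_def)
  then show ?thesis using assms by (simp add: diag_expansion_from_def)
qed

text \<open>If all earlier coefficients agree, the difference of the two remainders is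
  \<open>diag_var powi n * pullback2 (f n - g n)\<close> and lies one order deeper; restriction to
  the diagonal gives \<open>f n = g n\<close>.\<close>

lemma diag_expansion_from_unique:
  assumes "diag_expansion_from n0 F f" "diag_expansion_from n0 F g"
  shows "f = g"
proof -
  define S where "S h m = (\<Sum>n\<in>{n0..m}. diag_var powi n * pullback2 (h n))" for h :: "int \<Rightarrow> 'a fls" and m
  have S: "F - S f m \<in> diag_power (m + 1) K2" "F - S g m \<in> diag_power (m + 1) K2" for m
    using assms by (simp_all add: diag_expansion_from_def S_def)
  have "f n = g n" if "n \<ge> n0" for n
    using that
  proof (induction "nat (n - n0)" arbitrary: n rule: less_induct)
    case less
    have ih: "f k = g k" if "n0 \<le> k" "k < n" for k
      using that less by simp
    have ins: "{n0..n} = insert n {n0..n - 1}" using less.prems by auto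
    have "S f (n - 1) = S g (n - 1)" unfolding S_def using ih by (intro sum.cong) auto
    then have "(F - S g n) - (F - S f n) = diag_var powi n * pullback2 (f n - g n)"
      unfolding S_def by (simp add: ins algebra_simps pullback2_diff)
    then have "diag_var powi n * pullback2 (f n - g n) \<in> diag_power (n + 1) K2"
      using diag_power_diff[OF S(2,1)] by metis
    then obtain H where H: "H \<in> K2" "diag_var powi n * pullback2 (f n - g n) = diag_var powi (n + 1) * H"
      by (auto simp: diag_power_eq)
    then have "pullback2 (f n - g n) = diag_var * H"
      by (simp add: diag_var_powi_Suc mult.assoc)
    then show ?case using pullback2_eq_diag_var_mult H(1) by fastforce
  qed
  moreover have "f n = g n" if "n < n0" for n
    using assms that by (simp add: diag_expansion_from_def)
  ultimately show ?thesis by (metis linorder_not_less ext)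
qed

lemma diag_coeff_eq:
  assumes "diag_expansion_from n0 F f"
  shows "diag_coeff F = f"
  unfolding diag_coeff_def
proof (rule the_equality)
  show "is_diag_expansion F f" using assms is_diag_expansion_iff by blast
  fix g assume "is_diag_expansion F g"
  then obtain n1 where "diag_expansion_from n1 F g" using is_diag_expansion_iff by blast
  then show "g = f"
    using assms diag_expansion_from_unique[of "min n0 n1" F]
    by (metis diag_expansion_from_antimono min.cobounded1 min.cobounded2)
qed

lemma diag_expansion_from_ex:
  fixes G :: "'k::field fls fls"
  assumes "G \<in> K2"
  obtains f where "diag_expansion_from n0 (diag_var powi n0 * G) f"
proof -
  have "\<forall>G. \<exists>f H. G \<in> K2 \<longrightarrow> H \<in> K2 \<and> G = pullback2 f + diag_var * (H :: 'k fls fls)"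
    using K2_decomposition by metis
  then obtain r H where rH: "\<And>G. G \<in> K2 \<Longrightarrow> H G \<in> K2 \<and> G = pullback2 (r G) + diag_var * (H G :: 'k fls fls)"
    by metis
  \<comment> \<open>The k-th successive quotient by \<open>t1 - t2\<close> after removal of
    restrictions to the diagonal; those restrictions are the coefficients.\<close>
  define Gs where "Gs k = (H ^^ k) G" for k
  have Gs: "Gs k \<in> K2" for k by (induction k) (simp_all add: Gs_def assms rH)
  define f where "f n = (if n < n0 then 0 else r (Gs (nat (n - n0))))" for n
  have main: "diag_var powi n0 * G - (\<Sum>n\<in>{n0..n0 + int k - 1}. diag_var powi n * pullback2 (f n))
      = diag_var powi (n0 + int k) * Gs k" for k
  proof (induction k)
    case (Suc k)
    have "{n0..n0 + int (Suc k) - 1} = insert (n0 + int k) {n0..n0 + int k - 1}" by auto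
    then have "diag_var powi n0 * G - (\<Sum>n\<in>{n0..n0 + int (Suc k) - 1}. diag_var powi n * pullback2 (f n))
       = diag_var powi (n0 + int k) * Gs k - diag_var powi (n0 + int k) * pullback2 (f (n0 + int k))"
      using Suc by (simp add: algebra_simps)
    also have "\<dots> = diag_var powi (n0 + int k) * (Gs k - pullback2 (r (Gs k)))"
      by (simp add: f_def algebra_simps)
    also have "Gs k - pullback2 (r (Gs k)) = diag_var * Gs (Suc k)"
      using rH[OF Gs[of k]] unfolding Gs_def funpow.simps comp_def by (metis add_diff_cancel_left')
    also have "diag_var powi (n0 + int k) * (diag_var * Gs (Suc k)) = diag_var powi (n0 + int (Suc k)) * Gs (Suc k)"
    proof -
      have "n0 + int (Suc k) = n0 + int k + 1" by simp
      then show ?thesis by (simp only: diag_var_powi_Suc mult.assoc)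
    qed
    finally show ?case .
  qed (simp add: Gs_def)
  have "diag_expansion_from n0 (diag_var powi n0 * G) f"
    unfolding diag_expansion_from_def
  proof (intro conjI allI impI)
    fix m
    show "diag_var powi n0 * G - (\<Sum>n\<in>{n0..m}. diag_var powi n * pullback2 (f n)) \<in> diag_power (m + 1) K2"
    proof (cases "m < n0")
      case True
      then show ?thesis using assms diag_power_antimono[of "m + 1" n0 "diag_var powi n0 * G"]
        by (simp add: diag_power_eq)
    next
      case False
      then show ?thesis using main[of "nat (m + 1 - n0)"] Gs by (simp add: diag_power_eq)
    qed
  qed (simp add: f_def)
  then show ?thesis by (rule that)
qed

text \<open>Prepends one term. With \<open>diag_expansion_from_ex\<close> expanding the tail, the
  first two coefficients, which is what biresidue and \<open>Res12\<close> ask for, can be read off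
  without computing the rest.\<close>

lemma diag_expansion_from_step:
  assumes "diag_expansion_from (n0 + 1) (diag_var powi (n0 + 1) * G) f" "G \<in> K2"
  shows "diag_expansion_from n0 (diag_var powi n0 * (pullback2 a + diag_var * G)) (f(n0 := a))"
  unfolding diag_expansion_from_def
proof (intro conjI allI impI)
  fix m
  define F where "F = diag_var powi n0 * (pullback2 a + diag_var * G)"
  show "F - (\<Sum>n\<in>{n0..m}. diag_var powi n * pullback2 ((f(n0 := a)) n)) \<in> diag_power (m + 1) K2"
  proof (cases "m < n0")
    case True
    have "F \<in> diag_power n0 K2" using assms(2)
      by (auto simp: F_def diag_power_eq intro!: K2_add K2_mult)
    then show ?thesis using True diag_power_antimono[of "m + 1" n0 F] by simp
  next
    case False
    then have "{n0..m} = insert n0 {n0 + 1..m}" by auto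
    moreover have "(\<Sum>n\<in>{n0 + 1..m}. diag_var powi n * pullback2 ((f(n0 := a)) n))
        = (\<Sum>n\<in>{n0 + 1..m}. diag_var powi n * pullback2 (f n))"
      by (rule sum.cong) auto
    moreover have "F = diag_var powi n0 * pullback2 a + diag_var powi (n0 + 1) * G"
      unfolding F_def diag_var_powi_Suc by (simp add: algebra_simps)
    ultimately show ?thesis using assms(1) by (simp add: diag_expansion_from_def)
  qed
qed (use assms(1) in \<open>simp add: diag_expansion_from_def\<close>)

lemma diag_coeff_first:
  assumes "G \<in> K2"
  shows "diag_coeff (diag_var powi n * (pullback2 a + diag_var * G)) n = a"
proof -
  obtain f where "diag_expansion_from (n + 1) (diag_var powi (n + 1) * G) f"
    using diag_expansion_from_ex[OF assms] .
  from diag_coeff_eq[OF diag_expansion_from_step[OF this assms]] show ?thesis by simp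
qed

lemma diag_coeff_second:
  assumes "G \<in> K2"
  shows "diag_coeff (diag_var powi n * (pullback2 a + diag_var * (pullback2 b + diag_var * G))) (n + 1) = b"
proof -
  obtain f where "diag_expansion_from (n + 1 + 1) (diag_var powi (n + 1 + 1) * G) f"
    using diag_expansion_from_ex[OF assms] .
  from diag_expansion_from_step[OF this assms]
  have "diag_expansion_from (n + 1) (diag_var powi (n + 1) * (pullback2 b + diag_var * G)) (f(n + 1 := b))" .
  from diag_coeff_eq[OF diag_expansion_from_step[OF this]] show ?thesis
    using assms by (simp add: K2_add K2_mult)
qed

section \<open>The involution exchanging the two factors\<close>

lemma swap_K2_coeff:
  assumes "G \<in> K2"
  shows "bicoeff (swap_K2 G) i j = bicoeff G j i"
proof -
  obtain N where N: "\<And>i j. min i j < N \<Longrightarrow> bicoeff G i j = 0" using assms unfolding K2_def by blast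
  obtain H where H: "\<And>i j. bicoeff H i j = bicoeff G j i"
    using bicoeff_ex[of N "\<lambda>i j. bicoeff G j i"] N by (metis min.commute)
  have "swap_K2 G = H"
    unfolding swap_K2_def by (rule the_equality) (auto simp: H intro: bicoeff_eqI)
  then show ?thesis using H by simp
qed

lemma swap_K2_K2:
  assumes "G \<in> K2"
  shows "swap_K2 G \<in> K2"
proof -
  obtain N where N: "\<And>i j. min i j < N \<Longrightarrow> bicoeff G i j = 0" using assms unfolding K2_def by blast
  then show ?thesis by (intro K2_I[of N]) (simp add: swap_K2_coeff assms min.commute)
qed

lemma swap_K2_add: "F \<in> K2 \<Longrightarrow> G \<in> K2 \<Longrightarrow> swap_K2 (F + G) = swap_K2 F + swap_K2 G"
  by (rule bicoeff_eqI) (simp add: swap_K2_coeff K2_add)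

lemma swap_K2_1: "swap_K2 1 = 1"
  by (rule bicoeff_eqI) (auto simp add: swap_K2_coeff bicoeff_1)

lemma swap_K2_pullback2: "swap_K2 (pullback2 f) = pullback1 f"
  by (rule bicoeff_eqI) (simp add: swap_K2_coeff bicoeff_pullback2 bicoeff_pullback1)

lemma swap_K2_diag_var_mult: "G \<in> K2 \<Longrightarrow> swap_K2 (diag_var * G) = - (diag_var * swap_K2 G)"
  by (rule bicoeff_eqI) (simp add: swap_K2_coeff K2_mult bicoeff_diag_var_mult)

lemma swap_K2_diag_var_power_mult:
  "G \<in> K2 \<Longrightarrow> swap_K2 (diag_var ^ n * G) = (- diag_var) ^ n * swap_K2 G"
proof (induction n)
  case (Suc n)
  have "swap_K2 (diag_var ^ Suc n * G) = - (diag_var * swap_K2 (diag_var ^ n * G))"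
    using Suc.prems by (simp add: mult.assoc swap_K2_diag_var_mult K2_mult)
  then show ?case using Suc by (simp add: algebra_simps)
qed simp

text \<open>The definite description ranges over all ways of writing the element. Two of them differ
  by moving a power of \<open>diag_var\<close> into the factor from \<open>K2\<close>, and the swap
  turns it into the same power of \<open>- diag_var\<close>, matching the change of the outer
  power.\<close>

lemma involution_powi:
  assumes "G \<in> K2"
  shows "involution (diag_var powi n * G) = (- diag_var) powi n * swap_K2 G"
proof -
  have v: "- diag_var \<noteq> (0 :: 'a fls fls)" using diag_var_nonzero by simp
  have wd: "(- diag_var) powi n * swap_K2 G = (- diag_var) powi m * swap_K2 G'"
    if "m \<le> n" "G \<in> K2" "G' \<in> K2" "diag_var powi n * G = diag_var powi m * G'"
    for n m :: int and G G' :: "'a fls fls"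
  proof -
    have "diag_var powi m * G' = diag_var powi m * (diag_var ^ nat (n - m) * G)"
      using that(4) unfolding power_int_split[OF diag_var_nonzero that(1)] by (simp only: mult.assoc)
    then have "G' = diag_var ^ nat (n - m) * G" by simp
    then have "swap_K2 G' = (- diag_var) ^ nat (n - m) * swap_K2 G"
      using that(2) swap_K2_diag_var_power_mult by blast
    moreover have "(- diag_var) powi n = (- diag_var) powi m * (- diag_var :: 'a fls fls) ^ nat (n - m)"
      using v that(1) by (rule power_int_split)
    ultimately show ?thesis by (simp add: mult.assoc)
  qed
  have t: "t1 - t2 = (diag_var :: 'a fls fls)" "t2 - t1 = (- diag_var :: 'a fls fls)"
    by (simp_all add: diag_var_def)
  show ?thesis unfolding involution_def t
  proof (rule the_equality)
    fix H assume "\<exists>m. \<exists>G'\<in>K2. diag_var powi n * G = diag_var powi m * G' \<and> H = (- diag_var) powi m * swap_K2 G'"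
    then obtain m G' where "G' \<in> K2" "diag_var powi n * G = diag_var powi m * G'"
      "H = (- diag_var) powi m * swap_K2 G'" by blast
    then show "H = (- diag_var) powi n * swap_K2 G"
      using wd[of m n G G'] wd[of n m G' G] assms by (metis linear)
  qed (use assms in blast)
qed

lemma involution_O2: "G \<in> O2 \<Longrightarrow> involution G = swap_K2 G"
  using involution_powi[of G 0] O2_subset_K2[of G] by simp

lemma Omega2_sym_iff: "\<xi> \<in> Omega2_sym \<longleftrightarrow> \<xi> \<in> O2 \<and> (\<forall>i j. bicoeff \<xi> i j = bicoeff \<xi> j i)"
proof -
  have "swap_K2 \<xi> = \<xi> \<longleftrightarrow> (\<forall>i j. bicoeff \<xi> i j = bicoeff \<xi> j i)" if "\<xi> \<in> K2"
    using that by (metis bicoeff_eqI swap_K2_coeff)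
  then show ?thesis using O2_subset_K2[of \<xi>] by (auto simp: Omega2_sym_def involution_O2)
qed


text \<open>
  The coefficient of \<open>t\<^sub>1\<^sup>a t\<^sub>2\<^sup>c\<close> in the quotient by \<open>(t\<^sub>1 - t\<^sub>2)\<^sup>2\<close> of the Taylor remainder
  \<open>t\<^sub>1\<^sup>n - t\<^sub>2\<^sup>n - n t\<^sub>2\<^sup>n\<^sup>-\<^sup>1 (t\<^sub>1 - t\<^sub>2)\<close>, where \<open>n = a + c + 2\<close>.
\<close>

definition taylor_weight :: "int \<Rightarrow> int \<Rightarrow> int" where
  "taylor_weight a c = (if 0 \<le> a \<and> 0 \<le> c then c + 1 else if a < 0 \<and> c < 0 then - c - 1 else 0)"

text \<open>The left side is the effect of multiplication by (t1 - t2)^2 along an antidiagonal; the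
  right side lists the coefficients of t1^n - t2^n - n t2^(n-1) (t1 - t2) for n = i + j.\<close>

lemma taylor_weight_second_difference:
  "taylor_weight (i - 2) j - 2 * taylor_weight (i - 1) (j - 1) + taylor_weight i (j - 2) =
    (if j = 0 then 1 else 0) - (if i = 0 then 1 - j else 0) - (if i = 1 then j + 1 else 0)"
proof -
  \<comment> \<open>The weight changes form only at index 0 and the shifts are at most 2, so these
    cases suffice.\<close>
  have "i < 0 \<or> i = 0 \<or> i = 1 \<or> i \<ge> 2" "j < 0 \<or> j = 0 \<or> j = 1 \<or> j \<ge> 2" by linarith+
  then show ?thesis by (elim disjE) (simp_all add: taylor_weight_def)
qed

text \<open>The point is that the remainder \<open>H\<close> lies in \<open>K2\<close>: the weight
  vanishes unless both indices lie on the same side of 0, and two negative indices are bounded below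
  through the pole order of \<open>f\<close>. Used for the symmetry argument and for
  \<open>Res12\<close>.\<close>

lemma pullback1_taylor:
  fixes f :: "'k::field_char_0 fls"
  obtains H where "H \<in> K2"
    "pullback1 f = pullback2 f + diag_var * (pullback2 (fls_deriv f) + diag_var * H)"
proof -
  obtain N where N: "\<forall>n<N. fls_nth f n = 0" by (elim fls_nth_vanishes_belowE)
  define h where "h a c = of_int (taylor_weight a c) * fls_nth f (a + c + 2)" for a c
  have z: "h a c = 0" if "min a c < min N 0 - 2" for a c
  proof (cases "taylor_weight a c = 0")
    case False
    then have "a < 0 \<and> c < 0" using that by (auto simp: taylor_weight_def split: if_splits)
    then have "a + c + 2 < N" using that by linarith
    then show ?thesis using N by (simp add: h_def)
  qed (simp add: h_def)
  obtain H where H: "\<And>i j. bicoeff H i j = h i j"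
    using bicoeff_ex[of "min N 0 - 2" h] z by blast
  have "H \<in> K2" using z by (intro K2_I[of "min N 0 - 2"]) (simp add: H)
  moreover have "pullback1 f = pullback2 f + diag_var * (pullback2 (fls_deriv f) + diag_var * H)"
  proof (rule bicoeff_eqI)
    fix i j :: int
    let ?x = "fls_nth f (i + j)"
    have "bicoeff (diag_var * (diag_var * H)) i j = h (i - 2) j - 2 * h (i - 1) (j - 1) + h i (j - 2)"
      unfolding bicoeff_diag_var_mult H by simp
    also have "\<dots> = of_int (taylor_weight (i - 2) j - 2 * taylor_weight (i - 1) (j - 1)
        + taylor_weight i (j - 2)) * ?x"
    proof -
      have "i - 2 + j + 2 = i + j" "i - 1 + (j - 1) + 2 = i + j" "i + (j - 2) + 2 = i + j" by simp_all
      then show ?thesis unfolding h_def by (simp only: of_int_add of_int_diff of_int_mult of_int_numeral ring_distribs mult.assoc)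
    qed
    finally have HH: "bicoeff (diag_var * (diag_var * H)) i j =
      of_int ((if j = 0 then 1 else 0) - (if i = 0 then 1 - j else 0) - (if i = 1 then j + 1 else 0)) * ?x"
      unfolding taylor_weight_second_difference .
    have "bicoeff (diag_var * pullback2 (fls_deriv f)) i j =
      of_int ((if i = 1 then j + 1 else 0) - (if i = 0 then j else 0)) * ?x"
      unfolding bicoeff_diag_var_mult bicoeff_pullback2 fls_deriv_nth
      by (cases "i = 1"; cases "i = 0") (simp_all add: add.commute)
    then show "bicoeff (pullback1 f) i j =
        bicoeff (pullback2 f + diag_var * (pullback2 (fls_deriv f) + diag_var * H)) i j"
      unfolding distrib_left bicoeff_add HH bicoeff_pullback1 bicoeff_pullback2
      by (cases "i = 0"; cases "i = 1"; cases "j = 0") (simp_all add: ring_distribs)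
  qed
  ultimately show ?thesis by (rule that)
qed

section \<open>Symmetric bidifferentials with biresidue one\<close>

lemma Omega_iff: "h \<in> Omega \<longleftrightarrow> (\<forall>n<0. fls_nth h n = 0)"
proof
  assume "\<forall>n<0. fls_nth h n = 0"
  then have "h = fps_to_fls (fls_regpart h)"
    by (intro fls_eqI) auto
  then show "h \<in> Omega" unfolding Omega_def by blast
qed (auto simp: Omega_def)

lemma Omega_0 [simp]: "0 \<in> Omega"
  by (simp add: Omega_iff)

lemma Omega_add: "f \<in> Omega \<Longrightarrow> g \<in> Omega \<Longrightarrow> f + g \<in> Omega"
  by (simp add: Omega_iff)

lemma Omega_diff: "f \<in> Omega \<Longrightarrow> g \<in> Omega \<Longrightarrow> f - g \<in> Omega"
  by (simp add: Omega_iff)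

lemma Omega_scale: "f \<in> Omega \<Longrightarrow> fls_const c * f \<in> Omega"
  by (simp add: Omega_iff)

lemma Omega_const [simp]: "fls_const c \<in> Omega"
  by (simp add: Omega_iff)

lemma fls_deriv_in_Omega_iff: "fls_deriv f \<in> Omega \<longleftrightarrow> f \<in> Omega"
  for f :: "'k::field_char_0 fls"
proof
  assume f: "fls_deriv f \<in> Omega"
  have "fls_nth f n = 0" if "n < 0" for n
  proof -
    have "fls_nth (fls_deriv f) (n - 1) = 0" using f that by (simp add: Omega_iff del: fls_deriv_nth)
    then show ?thesis using that by simp
  qed
  then show "f \<in> Omega" by (simp add: Omega_iff)
next
  assume f: "f \<in> Omega"
  have "of_int (n + 1) * fls_nth f (n + 1) = 0" if "n < 0" for n
    \<comment> \<open>At \<open>n = - 1\<close> the factor \<open>n + 1\<close> is zero, which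
      matters because the constant term of \<open>f\<close> may be nonzero.\<close>
    using f that by (cases "n = - 1") (auto simp: Omega_iff)
  then show "fls_deriv f \<in> Omega" by (simp add: Omega_iff)
qed

lemma fls_integral_in_Omega: "f \<in> Omega \<Longrightarrow> fls_integral f \<in> Omega"
  for f :: "'k::field_char_0 fls"
  by (simp add: Omega_iff)

lemma residue_Omega: "h \<in> Omega \<Longrightarrow> fls_residue h = 0"
  by (simp add: Omega_iff)

lemma Omega_mult: "f \<in> Omega \<Longrightarrow> g \<in> Omega \<Longrightarrow> f * g \<in> Omega"
  by (auto simp: Omega_def simp flip: fls_times_fps_to_fls)

text \<open>A Laurent series is a regular series plus finitely many polar monomials, so additive
  claims on k((t)) need no continuity argument. The proof removes the lowest polar term
  repeatedly.\<close>

lemma fls_polar_induct [case_names Omega polar add]: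
  assumes "\<And>f. f \<in> Omega \<Longrightarrow> P f"
    and "\<And>c n. P (fls_const c * fls_X_intpow (- int n - 1))"
    and "\<And>F G. P F \<Longrightarrow> P G \<Longrightarrow> P (F + G)"
  shows "P (F :: 'k::field fls)"
proof -
  have "P F" if "\<forall>i < - int N. fls_nth F i = 0" for N F
    using that
  proof (induction N arbitrary: F)
    case 0
    then show ?case by (intro assms(1)) (simp add: Omega_iff)
  next
    case (Suc N)
    define M where "M = fls_const (fls_nth F (- int N - 1)) * fls_X_intpow (- int N - 1)"
    have "fls_nth (F - M) i = 0" if "i < - int N" for i
      using Suc.prems that by (cases "i = - int N - 1") (auto simp: M_def)
    then have "P (F - M)" using Suc.IH by blast
    moreover have "P M" unfolding M_def by (rule assms(2))
    ultimately have "P (F - M + M)" by (rule assms(3))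
    then show ?case by simp
  qed
  moreover obtain N where N: "\<forall>n<N. fls_nth F n = 0" by (elim fls_nth_vanishes_belowE)
  have "\<forall>i < - int (nat (- N)). fls_nth F i = 0" using N by auto
  ultimately show ?thesis by blast
qed

text \<open>The binomial series for t1 small compared with t2. Inverses in the field k((t2))((t1))
  are unique, so it suffices to multiply the series by (t1 - t2)^2.\<close>

lemma diag_var_inverse_square:
  "fls_nth (diag_var powi (-2) :: 'k::field fls fls) i =
    (if i \<ge> 0 then of_int (i + 1) * fls_X_intpow (- i - 2) else 0)"
proof -
  let ?v = "\<lambda>i. if i \<ge> 0 then of_int (i + 1) * fls_X_intpow (- i - 2) else (0 :: 'k fls)"
  define V where "V = Abs_fls ?v"
  have V: "fls_nth V i = ?v i" for i
    unfolding V_def by (rule nth_Abs_fls_lower_bound[of 0]) simp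
  have bV: "bicoeff V i j = of_int (if i \<ge> 0 \<and> i + j = - 2 then i + 1 else 0)" for i j
    by (auto simp add: bicoeff_def V fls_of_int)
  have "diag_var * (diag_var * V) = 1"
  proof (rule bicoeff_eqI)
    fix i j
    have "bicoeff (diag_var * (diag_var * V)) i j = bicoeff V (i - 2) j - 2 * bicoeff V (i - 1) (j - 1) + bicoeff V i (j - 2)"
      unfolding bicoeff_diag_var_mult by simp
    also have "\<dots> = bicoeff 1 i j"
    proof -
      have "i < 0 \<or> i = 0 \<or> i = 1 \<or> i \<ge> 2" by linarith
      then show ?thesis unfolding bV bicoeff_1 by (elim disjE) auto
    qed
    finally show "bicoeff (diag_var * (diag_var * V)) i j = bicoeff 1 i j" .
  qed
  then have "diag_var ^ 2 * V = 1" by (simp add: power2_eq_square mult.assoc)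
  then have "V = inverse (diag_var ^ 2)" by (metis inverse_unique)
  then have "diag_var powi (-2) = V" by (simp add: power_int_minus)
  then show ?thesis using V by simp
qed

text \<open>The source of the summand -d(t^(-n-1)) in the values of S on polar monomials.\<close>

lemma diag_var_inverse_square_deriv:
  "fls_nth (diag_var powi (-2) :: 'k::field_char_0 fls fls) (int n) = - fls_deriv (fls_X_intpow (- int n - 1))"
proof -
  have "- int n - 1 - 1 = - int n - 2" by simp
  then show ?thesis unfolding diag_var_inverse_square fls_deriv_X_intpow by (simp add: algebra_simps)
qed

lemma O2_iff: "\<xi> \<in> O2 \<longleftrightarrow> (\<forall>i<0. fls_nth \<xi> i = 0) \<and> (\<forall>n. fls_nth \<xi> (int n) \<in> Omega)"
proof
  assume \<xi>: "\<xi> \<in> O2"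
  have "fls_nth \<xi> i = 0" if "i < 0" for i
    using \<xi> that by (intro fls_eqI) (simp add: O2_def bicoeff_def)
  moreover have "fls_nth \<xi> (int n) \<in> Omega" for n
    using \<xi> by (simp add: O2_def bicoeff_def Omega_iff)
  ultimately show "(\<forall>i<0. fls_nth \<xi> i = 0) \<and> (\<forall>n. fls_nth \<xi> (int n) \<in> Omega)" by blast
next
  assume \<xi>: "(\<forall>i<0. fls_nth \<xi> i = 0) \<and> (\<forall>n. fls_nth \<xi> (int n) \<in> Omega)"
  have "bicoeff \<xi> i j = 0" if "min i j < 0" for i j
  proof (cases "i < 0")
    case False
    have "fls_nth \<xi> (int (nat i)) \<in> Omega" using \<xi> by blast
    moreover have "j < 0" using False that by linarith
    ultimately show ?thesis using False by (simp add: bicoeff_def Omega_iff)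
  qed (use \<xi> in \<open>simp add: bicoeff_def\<close>)
  then show "\<xi> \<in> O2" by (simp add: O2_def)
qed

lemma diag_var_powi_cancel: "diag_var powi (-2) * (diag_var * (diag_var * X)) = X"
proof -
  have "diag_var powi (-2) * (diag_var * (diag_var * X)) = (diag_var powi (-2) * diag_var ^ 2) * X"
    by (simp only: power2_eq_square mult.assoc)
  also have "diag_var powi (-2) * diag_var ^ 2 = (1 :: 'a fls fls)"
    using power_int_split[OF diag_var_nonzero, of "-2" 0] by simp
  finally show ?thesis by simp
qed

lemma Omega2_hat_sym_1_iff:
  "\<eta> \<in> Omega2_hat_sym_1 \<longleftrightarrow> (\<exists>\<xi>\<in>Omega2_sym. \<eta> = diag_var powi (-2) + \<xi>)"
  for \<eta> :: "'k::field_char_0 fls fls"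
proof
  have sq: "(- diag_var) powi (-2) = (diag_var powi (-2) :: 'k fls fls)"
    by (simp add: power_int_minus)
  assume \<eta>: "\<eta> \<in> Omega2_hat_sym_1"
  then obtain G where G: "G \<in> O2" "\<eta> = diag_var powi (-2) * G"
    by (auto simp: Omega2_hat_sym_1_def Omega2_hat_sym_def Omega2_hat_def diag_power_eq)
  note G' = O2_subset_K2[OF G(1)]
  obtain a H where H: "H \<in> K2" "G = pullback2 a + diag_var * H" using K2_decomposition[OF G'] .
  have "biresidue \<eta> = a" unfolding biresidue_def G(2) H(2) by (rule diag_coeff_first[OF H(1)])
  then have "a = 1" using \<eta> by (simp add: Omega2_hat_sym_1_def)
  have "involution \<eta> = diag_var powi (-2) * swap_K2 G"
    unfolding G(2) involution_powi[OF G'] sq ..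
  moreover have "involution \<eta> = \<eta>" using \<eta> by (simp add: Omega2_hat_sym_1_def Omega2_hat_sym_def)
  ultimately have symG: "swap_K2 G = G" using G(2) by simp
  have "swap_K2 G = 1 - diag_var * swap_K2 H"
    unfolding H(2) \<open>a = 1\<close> using H(1) by (simp add: swap_K2_add K2_mult swap_K2_1 swap_K2_diag_var_mult)
  then have "diag_var * (swap_K2 H + H) = 0"
    using symG H(2) \<open>a = 1\<close> by (simp add: algebra_simps)
  then have symH: "swap_K2 H + H = 0" by simp
  obtain b X where X: "X \<in> K2" "H = pullback2 b + diag_var * X" using K2_decomposition[OF H(1)] .
  \<comment> \<open>Swapping the variables turns \<open>pullback2 b\<close> into
    \<open>pullback1 b\<close>; by Taylor expansion both have the same restriction to the
    diagonal.\<close>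
  obtain Y where Y: "Y \<in> K2" "pullback1 b = pullback2 b + diag_var * (pullback2 (fls_deriv b) + diag_var * Y)"
    using pullback1_taylor .
  have swH: "swap_K2 H = pullback1 b - diag_var * swap_K2 X"
    unfolding X(2) using X(1) by (simp add: swap_K2_add K2_mult swap_K2_pullback2 swap_K2_diag_var_mult)
  have pb: "pullback2 (- b - b) = - pullback2 b - pullback2 b"
    using pullback2_diff[of "- b" b] pullback2_diff[of 0 b] by simp
  have "pullback1 b - diag_var * swap_K2 X + (pullback2 b + diag_var * X) = 0"
    using symH unfolding swH by (simp only: X(2))
  \<comment> \<open>Restricting \<open>swap_K2 H + H = 0\<close> to the diagonal leaves 2b = 0, and
    characteristic zero then gives b = 0.\<close>
  then have "pullback2 (- b - b) = diag_var * (pullback2 (fls_deriv b) + diag_var * Y - swap_K2 X + X)"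
    unfolding Y(2) pb by (simp add: algebra_simps)
  then have "- b - b = 0"
    by (rule pullback2_eq_diag_var_mult) (intro K2_add K2_diff K2_mult K2_pullback2 K2_diag_var X Y swap_K2_K2)
  then have "fls_nth (- b - b) n = 0" for n by simp
  then have "b = 0" by (intro fls_eqI) simp
  then have HX: "H = diag_var * X" using X(2) by simp
  \<comment> \<open>This product is \<open>G - 1\<close> and equals (t1 - t2)^2 X; the two factors
    are divided off one after the other, each time inside \<open>K2\<close>.\<close>
  have "diag_var * H \<in> O2"
  proof -
    have "bicoeff (diag_var * H) i j = bicoeff G i j - bicoeff 1 i j" for i j
      unfolding H(2) \<open>a = 1\<close> by simp
    then show ?thesis using G(1) by (auto simp: O2_def bicoeff_1)
  qed
  then have XO: "X \<in> O2" using O2_of_diag_var_mult H(1) X(1) HX by metis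
  have "diag_var * (swap_K2 X - X) = 0"
    using symH unfolding HX swap_K2_diag_var_mult[OF X(1)] by (simp add: algebra_simps)
  then have "X \<in> Omega2_sym" using XO by (simp add: Omega2_sym_def involution_O2)
  moreover have "\<eta> = diag_var powi (-2) + X"
  proof -
    have "G = 1 + diag_var * (diag_var * X)" unfolding H(2) HX \<open>a = 1\<close> by simp
    then show ?thesis unfolding G(2) by (simp only: distrib_left diag_var_powi_cancel mult_1_right)
  qed
  ultimately show "\<exists>\<xi>\<in>Omega2_sym. \<eta> = diag_var powi (-2) + \<xi>" by blast
next
  assume "\<exists>\<xi>\<in>Omega2_sym. \<eta> = diag_var powi (-2) + \<xi>"
  then obtain \<xi> where \<xi>: "\<xi> \<in> Omega2_sym" "\<eta> = diag_var powi (-2) + \<xi>" by blast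
  have \<xi>O: "\<xi> \<in> O2" using \<xi>(1) by (simp add: Omega2_sym_def)
  note \<xi>K = O2_subset_K2[OF \<xi>O]
  have sw: "swap_K2 \<xi> = \<xi>" using \<xi>(1) involution_O2[OF \<xi>O] by (simp add: Omega2_sym_def)
  \<comment> \<open>This form exhibits the double pole over a regular numerator, the biresidue 1
    and, the exponent being even, the symmetry.\<close>
  have \<eta>: "\<eta> = diag_var powi (-2) * (pullback2 1 + diag_var * (diag_var * \<xi>))"
    unfolding \<xi>(2) by (simp only: distrib_left diag_var_powi_cancel mult_1_right pullback2_1)
  have 1: "pullback2 1 + diag_var * (diag_var * \<xi>) \<in> O2"
    using \<xi>O unfolding O2_def pullback2_1
    by (auto simp: bicoeff_diag_var_mult bicoeff_1)
  have 2: "biresidue \<eta> = 1" unfolding biresidue_def \<eta>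
    by (intro diag_coeff_first K2_mult K2_diag_var \<xi>K)
  have "swap_K2 (pullback2 1 + diag_var * (diag_var * \<xi>)) = pullback2 1 + diag_var * (diag_var * \<xi>)"
    using \<xi>K by (simp add: swap_K2_add K2_mult swap_K2_1 swap_K2_diag_var_mult sw)
  then have 3: "involution \<eta> = \<eta>"
    unfolding \<eta> involution_powi[OF O2_subset_K2[OF 1]] by (simp add: power_int_minus)
  show "\<eta> \<in> Omega2_hat_sym_1"
    using 1 2 3 unfolding Omega2_hat_sym_1_def Omega2_hat_sym_def Omega2_hat_def diag_power_eq
    by (auto simp: \<eta> intro!: exI[of _ 1])
qed

text \<open>Once (t1 - t2)^(-2) is pulled out, \<open>\<xi>\<close> contributes to second order and
  beyond, so the coefficient sought is the first-order Taylor coefficient of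
  \<open>f\<close>.\<close>

lemma Res12_eq:
  assumes "\<eta> \<in> Omega2_hat_sym_1"
  shows "Res12 (pullback1 f * \<eta>) = fls_deriv (f :: 'k::field_char_0 fls)"
proof -
  obtain \<xi> where \<xi>: "\<xi> \<in> Omega2_sym" "\<eta> = diag_var powi (-2) + \<xi>"
    using assms unfolding Omega2_hat_sym_1_iff by blast
  have \<xi>K: "\<xi> \<in> K2" using \<xi>(1) unfolding Omega2_sym_def by (blast intro: O2_subset_K2)
  obtain H where H: "H \<in> K2" "pullback1 f = pullback2 f + diag_var * (pullback2 (fls_deriv f) + diag_var * H)"
    using pullback1_taylor .
  have "pullback1 f * \<eta> = diag_var powi (-2) * (pullback1 f + diag_var * (diag_var * (pullback1 f * \<xi>)))"
    unfolding \<xi>(2) distrib_left diag_var_powi_cancel by (simp only: mult.commute)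
  also have "pullback1 f + diag_var * (diag_var * (pullback1 f * \<xi>))
      = pullback2 f + diag_var * (pullback2 (fls_deriv f) + diag_var * (H + pullback1 f * \<xi>))"
    by (subst H(2)) (simp add: distrib_left add_ac)
  finally show ?thesis unfolding Res12_def
    using diag_coeff_second[of "H + pullback1 f * \<xi>" "-2" f "fls_deriv f"] H(1) \<xi>K
    by (simp add: K2_add K2_mult)
qed

section \<open>The operators of bidifferentials\<close>

text \<open>The last clause is isotropy of the image under d^(-1). An arbitrary primitive
  \<open>A\<close> stands for d^(-1) S F; its constant of integration is harmless since
  \<open>S G\<close> has residue zero by the clause before.\<close>

definition lagrangian_operator :: "('k::field_char_0 fls \<Rightarrow> 'k fls) \<Rightarrow> bool" where
  "lagrangian_operator S \<longleftrightarrow>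
     (\<forall>F G. S (F + G) = S F + S G) \<and> (\<forall>c F. S (fls_const c * F) = fls_const c * S F) \<and>
     (\<forall>f\<in>Omega. S f = 0) \<and> (\<forall>F. S F + fls_deriv F \<in> Omega) \<and>
     (\<forall>F G A. fls_deriv A = S F \<longrightarrow> fls_residue (A * S G) = 0)"

definition S_fls :: "'k::field fls fls \<Rightarrow> 'k fls \<Rightarrow> 'k fls" where
  "S_fls \<eta> F = Res1 (pullback1 F * \<eta>)"

lemma S_fls_add: "S_fls \<eta> (F + G) = S_fls \<eta> F + S_fls \<eta> G"
  by (simp add: S_fls_def Res1_def pullback1_add distrib_right)

lemma S_fls_scale: "S_fls \<eta> (fls_const c * F) = fls_const c * S_fls \<eta> F"
  by (simp add: S_fls_def Res1_def pullback1_scale mult.assoc)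

lemma S_fls_add_right: "S_fls (\<eta> + \<xi>) F = S_fls \<eta> F + S_fls \<xi> F"
  by (simp add: S_fls_def Res1_def distrib_left)

lemma S_fls_Omega:
  assumes "\<And>i. i < 0 \<Longrightarrow> fls_nth \<eta> i = 0" "f \<in> Omega"
  shows "S_fls \<eta> f = 0"
  unfolding S_fls_def Res1_def
  by (rule fls_mult_nth_eq_0[of 0 _ 0]) (use assms in \<open>auto simp: Omega_iff\<close>)

text \<open>Multiplication by t1^(-n-1) moves the coefficient of t1^n to t1^(-1). So S on polar
  monomials lists the coefficients of the bidifferential, which gives both injectivity and
  reconstruction.\<close>

lemma S_fls_polar: "S_fls \<eta> (fls_X_intpow (- int n - 1)) = fls_nth \<eta> (int n)"
  unfolding S_fls_def Res1_def pullback1_X_intpow fls_X_intpow_times_conv_shift by simp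

lemma residue_X_intpow_mult: "fls_residue (fls_X_intpow (- int n - 1) * f) = fls_nth f (int n)"
  for f :: "'k::field fls"
  unfolding fls_X_intpow_times_conv_shift by simp

text \<open>Regular against regular and polar against polar have no t^(-1) term; the two mixed
  products remain, one of them evaluated by integration by parts.\<close>

lemma residue_polar_pairing:
  fixes x y :: "'k::field_char_0 fls"
  assumes "x \<in> Omega" "y \<in> Omega"
  shows "fls_residue ((fls_integral x - fls_X_intpow (- int m - 1)) * (y - fls_deriv (fls_X_intpow (- int n - 1))))
    = fls_nth x (int n) - fls_nth y (int m)"
proof -
  let ?a = "fls_X_intpow (- int m - 1) :: 'k fls" and ?b = "fls_X_intpow (- int n - 1) :: 'k fls"
  have dx: "fls_deriv (fls_integral x) = x"
    using assms(1) by (intro fls_deriv_fls_integral residue_Omega)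
  have "fls_residue (fls_integral x * y) = 0"
    using assms by (intro residue_Omega Omega_mult fls_integral_in_Omega)
  moreover have "fls_residue (fls_integral x * fls_deriv ?b) = - fls_nth x (int n)"
  proof -
    have "fls_residue (fls_integral x * fls_deriv ?b) = - fls_residue (?b * x)"
      using fls_residue_times_deriv[of "fls_integral x" ?b] unfolding dx by (simp add: mult.commute)
    then show ?thesis unfolding residue_X_intpow_mult .
  qed
  moreover have "fls_residue (?a * y) = fls_nth y (int m)"
    by (rule residue_X_intpow_mult)
  moreover have "fls_residue (?a * fls_deriv ?b) = 0"
    unfolding residue_X_intpow_mult by simp
  ultimately show ?thesis by (simp add: algebra_simps del: fls_deriv_nth)
qed

lemma lagrangian_operator_S_fls:
  assumes "\<eta> \<in> Omega2_hat_sym_1"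
  shows "lagrangian_operator (S_fls (\<eta> :: 'k::field_char_0 fls fls))"
proof -
  obtain \<xi> where \<xi>: "\<xi> \<in> Omega2_sym" "\<eta> = diag_var powi (-2) + \<xi>"
    using assms unfolding Omega2_hat_sym_1_iff by blast
  have \<xi>O: "\<xi> \<in> O2" and sym: "bicoeff \<xi> i j = bicoeff \<xi> j i" for i j
    using \<xi>(1) unfolding Omega2_sym_iff by blast+
  let ?S = "S_fls \<eta>"
  have neg: "fls_nth \<eta> i = 0" if "i < 0" for i
    using that \<xi>O unfolding \<xi>(2) O2_iff by (simp add: diag_var_inverse_square)
  note vanish = S_fls_Omega[OF neg]
  have pol: "?S (fls_X_intpow (- int n - 1)) = fls_nth \<xi> (int n) - fls_deriv (fls_X_intpow (- int n - 1))" for n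
    unfolding S_fls_polar \<xi>(2) using diag_var_inverse_square_deriv[of n] by simp
  have \<xi>n: "fls_nth \<xi> (int n) \<in> Omega" for n using \<xi>O unfolding O2_iff by blast
  have near: "?S F + fls_deriv F \<in> Omega" for F
  proof (induction F rule: fls_polar_induct)
    case (Omega f)
    then show ?case by (simp add: vanish fls_deriv_in_Omega_iff)
  next
    case (polar c n)
    have "?S (fls_const c * fls_X_intpow (- int n - 1)) + fls_deriv (fls_const c * fls_X_intpow (- int n - 1))
      = fls_const c * fls_nth \<xi> (int n)"
      unfolding S_fls_scale pol fls_deriv_mult_const_left by (simp only: ring_distribs diff_add_cancel)
    then show ?case using Omega_scale[OF \<xi>n] by (simp only:)
  next
    case (add F G)
    then have "(?S F + fls_deriv F) + (?S G + fls_deriv G) \<in> Omega" by (rule Omega_add)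
    then show ?case by (simp add: S_fls_add add_ac)
  qed
  have res0: "fls_residue (?S F) = 0" for F
    using residue_Omega[OF near[of F]] by simp
  \<comment> \<open>First for the primitive \<open>fls_integral\<close>, whose linearity lets both
    arguments be reduced to polar monomials; there the residue is a difference of two mirrored
    coefficients of \<open>\<xi>\<close>.\<close>
  have iso: "fls_residue (fls_integral (?S F) * ?S G) = 0" for F G
  proof (induction F rule: fls_polar_induct)
    case (polar c m)
    show ?case
    proof (induction G rule: fls_polar_induct)
      case (polar d n)
      let ?a = "fls_X_intpow (- int m - 1) :: 'k fls" and ?b = "fls_X_intpow (- int n - 1) :: 'k fls"
      \<comment> \<open>Integrating a derivative loses the constant term, which a monomial of
        exponent -m-1 does not have.\<close>
      have "fls_integral (fls_deriv ?a) = ?a"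
        using fls_integral_fls_deriv[of ?a] by simp
      then have "fls_residue (fls_integral (?S ?a) * ?S ?b) = fls_nth (fls_nth \<xi> (int m)) (int n) - fls_nth (fls_nth \<xi> (int n)) (int m)"
        using residue_polar_pairing[OF \<xi>n \<xi>n] unfolding pol by simp
      also have "\<dots> = 0" using sym[of "int m" "int n"] by (simp add: bicoeff_def)
      finally have "fls_residue (fls_integral (?S ?a) * ?S ?b) = 0" .
      moreover have "fls_integral (?S (fls_const c * ?a)) * ?S (fls_const d * ?b)
          = fls_const (c * d) * (fls_integral (?S ?a) * ?S ?b)"
        unfolding S_fls_scale fls_integral_mult_const_left by (simp add: mult_ac flip: fls_const_mult_const)
      ultimately show ?case by (simp only: fls_residue_fls_const_times mult_zero_right)
    qed (simp_all add: vanish S_fls_add distrib_left)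
  qed (simp_all add: vanish S_fls_add distrib_right)
  have "fls_residue (A * ?S G) = 0" if "fls_deriv A = ?S F" for A F G
  proof -
    have "A = fls_integral (?S F) + fls_const (fls_nth A 0)"
      using fls_integral_fls_deriv[of A] that by simp
    then have "A * ?S G = fls_integral (?S F) * ?S G + fls_const (fls_nth A 0) * ?S G"
      by (metis distrib_right)
    then have "fls_residue (A * ?S G) = fls_residue (fls_integral (?S F) * ?S G) + fls_nth A 0 * fls_residue (?S G)"
      by simp
    then show ?thesis unfolding iso res0 by simp
  qed
  then show ?thesis
    unfolding lagrangian_operator_def using near vanish S_fls_add S_fls_scale by blast
qed

context
  fixes S :: "'k::field_char_0 fls \<Rightarrow> 'k fls"
  assumes S: "lagrangian_operator S"
begin

lemma lop_add: "S (F + G) = S F + S G"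
  using S unfolding lagrangian_operator_def by blast

lemma lop_scale: "S (fls_const c * F) = fls_const c * S F"
  using S unfolding lagrangian_operator_def by blast

lemma lop_Omega: "f \<in> Omega \<Longrightarrow> S f = 0"
  using S unfolding lagrangian_operator_def by blast

lemma lop_near: "S F + fls_deriv F \<in> Omega"
  using S unfolding lagrangian_operator_def by blast

lemma lop_isotropic: "fls_deriv A = S F \<Longrightarrow> fls_residue (A * S G) = 0"
  using S unfolding lagrangian_operator_def by blast

lemma lop_uminus: "S (- F) = - S F"
  using lop_scale[of "-1" F] by simp

lemma lop_residue: "fls_residue (S F) = 0"
  using residue_Omega[OF lop_near[of F]] by simp

lemma lop_deriv_integral: "fls_deriv (fls_integral (S F)) = S F"
  by (rule fls_deriv_fls_integral) (rule lop_residue)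

lemma lop_eq_0_iff: "S F = 0 \<longleftrightarrow> F \<in> Omega"
  using lop_near[of F] lop_Omega[of F] by (auto simp: fls_deriv_in_Omega_iff)

text \<open>In terms of the endomorphism \<open>d\<^sup>-\<^sup>1 S\<close> of \<open>K'\<close> this says that its negative is idempotent.\<close>

lemma lop_idem:
  assumes "fls_deriv A = S F"
  shows "S A = - S F"
proof -
  have "fls_deriv (A + F) \<in> Omega" using lop_near[of F] assms by simp
  then have "S (A + F) = 0" by (simp only: fls_deriv_in_Omega_iff lop_Omega)
  then show ?thesis by (simp add: lop_add eq_neg_iff_add_eq_0)
qed

text \<open>\<open>S\<close> prescribes \<open>\<xi>\<close>: the coefficient of t1^n has to be
  S(t^(-n-1)) + d(t^(-n-1)), which is regular by \<open>lop_near\<close>. Isotropy on pairs of polar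
  monomials is the symmetry of \<open>\<xi>\<close>.\<close>

lemma lop_ex_S_fls: "\<exists>\<eta>\<in>Omega2_hat_sym_1. S_fls \<eta> = S"
proof -
  let ?X = "\<lambda>n. fls_X_intpow (- int n - 1) :: 'k fls"
  define x where "x n = S (?X n) + fls_deriv (?X n)" for n
  define \<xi> where "\<xi> = fps_to_fls (Abs_fps x)"
  have x: "x n \<in> Omega" for n unfolding x_def by (rule lop_near)
  have Sx: "S (?X n) = x n - fls_deriv (?X n)" for n by (simp add: x_def)
  have \<xi>n: "fls_nth \<xi> (int n) = x n" for n by (simp add: \<xi>_def)
  have \<xi>O: "\<xi> \<in> O2" unfolding O2_iff \<xi>n using x by (simp add: \<xi>_def)
  have symn: "fls_nth (x m) (int n) = fls_nth (x n) (int m)" for m n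
  proof -
    have "fls_deriv (fls_integral (x m)) = x m"
      using x by (intro fls_deriv_fls_integral residue_Omega)
    then have "fls_deriv (fls_integral (x m) - ?X m) = S (?X m)"
      unfolding Sx fls_deriv_sub by (simp only:)
    then have "fls_residue ((fls_integral (x m) - ?X m) * S (?X n)) = 0" by (rule lop_isotropic)
    then show ?thesis using residue_polar_pairing[OF x x, of m m n n] unfolding Sx by simp
  qed
  have "bicoeff \<xi> i j = bicoeff \<xi> j i" for i j
  proof (cases "i < 0 \<or> j < 0")
    case True
    then have "min i j < 0" "min j i < 0" by linarith+
    then show ?thesis using \<xi>O by (simp add: O2_def)
  next
    case False
    then have "i = int (nat i)" "j = int (nat j)" by simp_all
    then obtain m n where "i = int m" "j = int n" by blast
    then show ?thesis using symn[of m n] by (simp only: bicoeff_def \<xi>n)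
  qed
  then have \<xi>: "\<xi> \<in> Omega2_sym" using \<xi>O unfolding Omega2_sym_iff by blast
  define \<eta> where "\<eta> = diag_var powi (-2) + \<xi>"
  have \<eta>: "\<eta> \<in> Omega2_hat_sym_1" unfolding Omega2_hat_sym_1_iff \<eta>_def using \<xi> by blast
  have neg: "fls_nth \<eta> i = 0" if "i < 0" for i
    using that \<xi>O unfolding \<eta>_def O2_iff by (simp add: diag_var_inverse_square)
  have "S_fls \<eta> F = S F" for F
  proof (induction F rule: fls_polar_induct)
    case (Omega f)
    then show ?case by (simp add: S_fls_Omega[OF neg] lop_Omega)
  next
    case (polar c n)
    have "S_fls \<eta> (?X n) = S (?X n)"
      unfolding S_fls_polar Sx \<eta>_def using diag_var_inverse_square_deriv[of n, where 'k='k] by (simp add: \<xi>n)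
    then show ?case by (simp only: S_fls_scale lop_scale)
  qed (simp add: S_fls_add lop_add)
  then show ?thesis using \<eta> by blast
qed

end

lemma S_fls_inj:
  assumes "\<eta> \<in> Omega2_hat_sym_1" "\<eta>' \<in> Omega2_hat_sym_1" "S_fls \<eta> = S_fls \<eta>'"
  shows "\<eta> = (\<eta>' :: 'k::field_char_0 fls fls)"
proof (rule fls_eqI)
  fix i
  have neg: "fls_nth \<eta> i = 0" if "i < 0" "\<eta> \<in> Omega2_hat_sym_1" for \<eta> :: "'k fls fls"
    using that unfolding Omega2_hat_sym_1_iff Omega2_sym_def O2_iff by (auto simp: diag_var_inverse_square)
  show "fls_nth \<eta> i = fls_nth \<eta>' i"
  proof (cases "i < 0")
    case True
    then show ?thesis using neg assms by simp
  next
    case False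
    then have "fls_nth \<eta> (int (nat i)) = fls_nth \<eta>' (int (nat i))"
      using assms(3) unfolding S_fls_polar[symmetric] by simp
    then show ?thesis using False by simp
  qed
qed

section \<open>Lagrangian supplements\<close>

text \<open>The symplectic space is \<open>range Q\<close>, which need not be the whole type. This
  covers both a quotient map onto K' and the derivation with values in k((t)), whose range is
  Omega'_K.\<close>

locale laurent_quotient = Vector_Spaces.linear scale_Omega scale Q
  for scale :: "'k::field_char_0 \<Rightarrow> 'v::ab_group_add \<Rightarrow> 'v" and Q :: "'k fls \<Rightarrow> 'v" +
  assumes kernel: "Q F = 0 \<longleftrightarrow> F \<in> range fls_const"
begin

lemma Q_scale: "Q (fls_const c * F) = scale c (Q F)"
  using local.scale[of c F] by (simp add: scale_Omega_def)

lemma Q_eq_iff: "Q F = Q G \<longleftrightarrow> fls_deriv F = fls_deriv G"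
proof -
  have "Q F = Q G \<longleftrightarrow> Q (F - G) = 0" by (simp add: diff)
  also have "\<dots> \<longleftrightarrow> (\<exists>c. F = fls_const c + G)"
    unfolding kernel by (auto simp: algebra_simps)
  finally show ?thesis unfolding fls_deriv_eq_iff_ex .
qed

lemma Q_eq_0_iff: "Q F = 0 \<longleftrightarrow> fls_deriv F = 0"
  using Q_eq_iff[of F 0] by simp

abbreviation form :: "'v \<Rightarrow> 'v \<Rightarrow> 'k" where
  "form \<equiv> induced_form (\<lambda>F. F) Q"

text \<open>The form is well defined: a constant in the second argument is killed by d, one in the
  first contributes a multiple of the residue of a derivative.\<close>

lemma form_Q: "form (Q F) (Q G) = fls_residue (F * fls_deriv G)"
proof -
  have "fls_residue (f * fls_deriv g) = fls_residue (F * fls_deriv G)" if f: "Q f = Q F" and g: "Q g = Q G" for f g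
  proof -
    obtain c where "f = fls_const c + F" using f unfolding Q_eq_iff fls_deriv_eq_iff_ex by blast
    moreover have "fls_residue (fls_const c * fls_deriv G) = 0"
      unfolding fls_residue_fls_const_times fls_residue_deriv by simp
    ultimately show ?thesis using g unfolding Q_eq_iff by (simp add: distrib_right)
  qed
  then show ?thesis unfolding induced_form_def pairing_def diff_K_def by (intro the_equality) blast+
qed

definition graph :: "('k fls \<Rightarrow> 'k fls) \<Rightarrow> 'v set" where
  "graph S = Q ` {A. fls_deriv A \<in> range S}"

lemma Q_in_graph_iff: "Q A \<in> graph S \<longleftrightarrow> fls_deriv A \<in> range S"
  unfolding graph_def by (auto simp: Q_eq_iff)

lemma Q_in_Omega_iff: "Q A \<in> Q ` Omega \<longleftrightarrow> A \<in> Omega"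
proof
  assume "Q A \<in> Q ` Omega"
  then obtain f where "f \<in> Omega" "fls_deriv A = fls_deriv f" by (auto simp: Q_eq_iff)
  then show "A \<in> Omega" by (metis fls_deriv_in_Omega_iff)
qed blast

text \<open>If df = S F with f regular, then S f = 0 as S vanishes on O, and S f = - S F by
  \<open>lop_idem\<close>; so df = 0.\<close>

lemma graph_inter:
  assumes "lagrangian_operator S"
  shows "Q ` Omega \<inter> graph S = {0}"
proof -
  have "Q f = 0" if "f \<in> Omega" "Q f \<in> graph S" for f
  proof -
    have "fls_deriv f \<in> range S" using that(2) unfolding Q_in_graph_iff .
    then obtain F where F: "fls_deriv f = S F" by blast
    then have "S F = - S f" using lop_idem[OF assms F] by simp
    then show ?thesis using F lop_Omega[OF assms that(1)] by (simp add: Q_eq_0_iff)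
  qed
  moreover have "0 \<in> Q ` Omega" "0 \<in> graph S"
    using Q_in_Omega_iff[of 0] Q_in_graph_iff[of 0 S] lop_Omega[OF assms, of 0] by (auto intro: rev_image_eqI)
  ultimately show ?thesis by blast
qed

lemma graph_decomposition:
  assumes "lagrangian_operator S"
  obtains f A where "f \<in> Omega" "Q A \<in> graph S" "F = f + A"
proof
  \<comment> \<open>The value at \<open>F\<close> of the projection 1 + d^(-1) S onto regular
    series; the rest \<open>F - f\<close> is a primitive of - S F.\<close>
  define f where "f = fls_integral (S F + fls_deriv F)"
  show "f \<in> Omega" unfolding f_def by (intro fls_integral_in_Omega lop_near assms)
  have "fls_deriv f = S F + fls_deriv F"
    unfolding f_def by (intro fls_deriv_fls_integral residue_Omega lop_near assms)
  then have "fls_deriv (F - f) = S (- F)" using lop_uminus[OF assms, of F] by simp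
  then show "Q (F - f) \<in> graph S" unfolding Q_in_graph_iff by blast
qed simp

lemma subspace_graph:
  assumes "lagrangian_operator S"
  shows "vs2.subspace (graph S)"
proof (rule vs2.subspaceI)
  show "0 \<in> graph S" using graph_inter[OF assms] by blast
next
  fix x y assume "x \<in> graph S" "y \<in> graph S"
  then obtain A B F G where "x = Q A" "fls_deriv A = S F" "y = Q B" "fls_deriv B = S G"
    unfolding graph_def by blast
  then have "x + y = Q (A + B)" "fls_deriv (A + B) = S (F + G)"
    by (simp_all add: add lop_add[OF assms])
  then show "x + y \<in> graph S" unfolding graph_def by blast
next
  fix c x assume "x \<in> graph S"
  then obtain A F where "x = Q A" "fls_deriv A = S F"
    unfolding graph_def by blast
  then have "scale c x = Q (fls_const c * A)" "fls_deriv (fls_const c * A) = S (fls_const c * F)"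
    by (simp_all add: Q_scale lop_scale[OF assms])
  then show "scale c x \<in> graph S" unfolding graph_def by blast
qed

text \<open>One inclusion is isotropy. For the other, the regular component f of an annihilating
  element pairs to zero with the supplement, and with \<open>Omega\<close>, which is isotropic,
  hence with everything; nondegeneracy modulo constants leaves df = 0.\<close>

lemma annihilator_graph:
  assumes "lagrangian_operator S"
  shows "annihilator (range Q) form (graph S) = graph S"
proof (intro equalityI subsetI)
  fix x assume "x \<in> graph S"
  then obtain A F where x: "x = Q A" "fls_deriv A = S F" unfolding graph_def by blast
  have "form x y = 0" if "y \<in> graph S" for y
  proof -
    from that obtain B G where "y = Q B" "fls_deriv B = S G" unfolding graph_def by blast
    then show ?thesis using lop_isotropic[OF assms x(2), of G] unfolding x(1) by (simp add: form_Q)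
  qed
  then show "x \<in> annihilator (range Q) form (graph S)" using x(1) by (simp add: annihilator_def)
next
  fix x assume x: "x \<in> annihilator (range Q) form (graph S)"
  then obtain F where F: "x = Q F" by (auto simp: annihilator_def)
  obtain f A where f: "f \<in> Omega" and A: "Q A \<in> graph S" and FfA: "F = f + A"
    by (rule graph_decomposition[OF assms])
  obtain C where C: "fls_deriv A = S C" using A unfolding Q_in_graph_iff by blast
  have graph0: "fls_residue (f * fls_deriv B) = 0" if B: "Q B \<in> graph S" for B
  proof -
    have "form (Q F) (Q B) = 0" using x B unfolding F annihilator_def by blast
    then have "fls_residue (F * fls_deriv B) = 0" unfolding form_Q .
    moreover obtain G where "fls_deriv B = S G" using B unfolding Q_in_graph_iff by blast
    then have "fls_residue (A * fls_deriv B) = 0" using lop_isotropic[OF assms C] by simp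
    ultimately show ?thesis unfolding FfA by (simp add: distrib_right)
  qed
  have zero: "fls_residue (f * fls_deriv G) = 0" for G
  proof -
    obtain g B where "g \<in> Omega" "Q B \<in> graph S" "G = g + B"
      by (rule graph_decomposition[OF assms])
    moreover have "fls_residue (f * fls_deriv g) = 0"
      using f \<open>g \<in> Omega\<close> by (intro residue_Omega Omega_mult) (simp_all add: fls_deriv_in_Omega_iff)
    ultimately show ?thesis using graph0[of B] by (simp add: distrib_left del: fls_deriv_nth)
  qed
  have "fls_deriv f = 0"
  proof (rule fls_eqI)
    fix n
    \<comment> \<open>Pairing with t^(-n-1), after integration by parts, reads off the coefficient
      of t^n in df.\<close>
    have "fls_residue (fls_deriv f * fls_X_intpow (- n - 1)) = 0"
      using fls_residue_times_deriv zero by (metis neg_0_equal_iff_equal)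
    then show "fls_nth (fls_deriv f) n = fls_nth 0 n"
      unfolding fls_X_intpow_times_conv_shift by simp
  qed
  then have "Q F = Q A" unfolding FfA Q_eq_iff by simp
  then show "x \<in> graph S" using F A by simp
qed

lemma lagrangian_supplement_graph:
  assumes "lagrangian_operator S"
  shows "lagrangian_supplement scale (range Q) form (Q ` Omega) (graph S)"
  unfolding lagrangian_supplement_def lagrangian_def
proof (intro conjI)
  show "graph S \<subseteq> range Q" unfolding graph_def by blast
  show "{x + y |x y. x \<in> Q ` Omega \<and> y \<in> graph S} = range Q"
  proof (intro equalityI subsetI)
    fix x assume "x \<in> {x + y |x y. x \<in> Q ` Omega \<and> y \<in> graph S}"
    then show "x \<in> range Q" unfolding graph_def by (auto simp flip: add)
  next
    fix x assume "x \<in> range Q"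
    then obtain F where "x = Q F" by blast
    moreover obtain f A where "f \<in> Omega" "Q A \<in> graph S" "F = f + A"
      by (rule graph_decomposition[OF assms])
    ultimately show "x \<in> {x + y |x y. x \<in> Q ` Omega \<and> y \<in> graph S}" by (auto simp: add)
  qed
qed (fact subspace_graph[OF assms] annihilator_graph[OF assms] graph_inter[OF assms])+

text \<open>Primitives of S F and S' F lie in the common supplement, while S F - S' F = (S F + dF) -
  (S' F + dF) is regular; so they agree modulo constants.\<close>

lemma graph_inj:
  assumes "lagrangian_operator S" "lagrangian_operator S'" "graph S = graph S'"
  shows "S = S'"
proof
  fix F
  let ?A = "fls_integral (S F)" and ?B = "fls_integral (S' F)"
  have d: "fls_deriv ?A = S F" "fls_deriv ?B = S' F"
    using assms lop_deriv_integral by blast+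
  have "Q ?A \<in> graph S" "Q ?B \<in> graph S'"
    by (simp_all add: Q_in_graph_iff d)
  then have "Q (?A - ?B) \<in> graph S"
    unfolding diff assms(3)[symmetric] by (rule vs2.subspace_diff[OF subspace_graph[OF assms(1)]])
  moreover have "(S F + fls_deriv F) - (S' F + fls_deriv F) \<in> Omega"
    using assms by (intro Omega_diff lop_near)
  then have "fls_deriv (?A - ?B) \<in> Omega" unfolding fls_deriv_sub d by simp
  then have "Q (?A - ?B) \<in> Q ` Omega" unfolding fls_deriv_in_Omega_iff by blast
  ultimately have "Q (?A - ?B) = 0" using graph_inter[OF assms(1)] by blast
  then show "S F = S' F" unfolding Q_eq_0_iff fls_deriv_sub d by simp
qed

text \<open>The operator is -d composed with the projection onto \<open>L\<close> along the image of
  \<open>Omega\<close>.\<close>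

lemma lagrangian_supplement_ex_operator:
  assumes L: "lagrangian_supplement scale (range Q) form (Q ` Omega) L"
  shows "\<exists>S. lagrangian_operator S \<and> graph S = L"
proof -
  have sub: "vs2.subspace L" and LQ: "L \<subseteq> range Q" and ann: "annihilator (range Q) form L = L"
    and int: "Q ` Omega \<inter> L = {0}" and sum: "{x + y |x y. x \<in> Q ` Omega \<and> y \<in> L} = range Q"
    using L unfolding lagrangian_supplement_def lagrangian_def by blast+
  have "\<exists>A. Q A \<in> L \<and> F - A \<in> Omega" for F
  proof -
    have "Q F \<in> {x + y |x y. x \<in> Q ` Omega \<and> y \<in> L}" unfolding sum by blast
    then obtain f l where f: "f \<in> Omega" "l \<in> L" "Q F = Q f + l" by blast
    then have "Q (F - f) \<in> L" by (simp add: diff)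
    then show ?thesis using f(1) by (intro exI[of _ "F - f"]) simp
  qed
  \<comment> \<open>\<open>A F\<close> represents the component of \<open>F\<close> in
    \<open>L\<close>. As a choice it need not be linear; its derivative is, because
    \<open>uniq\<close> determines it.\<close>
  then obtain A where A: "\<And>F. Q (A F) \<in> L" "\<And>F. F - A F \<in> Omega" by metis
  have uniq: "fls_deriv (A F) = fls_deriv B" if "Q B \<in> L" "F - B \<in> Omega" for B F
  proof -
    have "Q (A F - B) \<in> L" unfolding diff by (rule vs2.subspace_diff[OF sub A(1) that(1)])
    moreover have "Q (A F - B) \<in> Q ` Omega"
      using Omega_diff[OF that(2) A(2)[of F]] by simp
    ultimately have "Q (A F - B) = 0" using int by blast
    then show ?thesis unfolding Q_eq_0_iff fls_deriv_sub by simp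
  qed
  define S where "S F = - fls_deriv (A F)" for F
  have "lagrangian_operator S"
    unfolding lagrangian_operator_def
  proof (intro conjI allI ballI impI)
    fix F G
    have "Q (A F + A G) \<in> L" unfolding add by (rule vs2.subspace_add[OF sub A(1) A(1)])
    moreover have "F + G - (A F + A G) \<in> Omega"
      using Omega_add[OF A(2)[of F] A(2)[of G]] by (simp add: algebra_simps)
    ultimately show "S (F + G) = S F + S G" unfolding S_def using uniq by simp
  next
    fix c F
    have "Q (fls_const c * A F) \<in> L" unfolding Q_scale by (rule vs2.subspace_scale[OF sub A(1)])
    moreover have "fls_const c * F - fls_const c * A F \<in> Omega"
      using Omega_scale[OF A(2)[of F], of c] by (simp add: right_diff_distrib)
    ultimately show "S (fls_const c * F) = fls_const c * S F" unfolding S_def using uniq by simp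
  next
    fix f :: "'k fls" assume "f \<in> Omega"
    then show "S f = 0" using uniq[of 0 f] vs2.subspace_0[OF sub] by (simp add: S_def)
  next
    fix F
    have "fls_deriv (F - A F) \<in> Omega" unfolding fls_deriv_in_Omega_iff by (rule A(2))
    then show "S F + fls_deriv F \<in> Omega" by (simp add: S_def)
  next
    fix F G B assume B: "fls_deriv B = S F"
    then have "Q B = Q (- A F)" unfolding Q_eq_iff by (simp add: S_def)
    then have "Q B \<in> L" using vs2.subspace_neg[OF sub A(1)[of F]] by (simp add: neg)
    moreover have "Q (- A G) \<in> L" using vs2.subspace_neg[OF sub A(1)[of G]] by (simp add: neg)
    ultimately have "form (Q B) (Q (- A G)) = 0" using ann unfolding annihilator_def by blast
    then show "fls_residue (B * S G) = 0" unfolding form_Q by (simp add: S_def)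
  qed
  moreover have "graph S = L"
  proof (intro equalityI subsetI)
    fix x assume "x \<in> graph S"
    then obtain B F where B: "x = Q B" "fls_deriv B = S F" unfolding graph_def by blast
    then have "x = Q (- A F)" unfolding B(1) Q_eq_iff by (simp add: S_def)
    then show "x \<in> L" using vs2.subspace_neg[OF sub A(1)[of F]] by (simp add: neg)
  next
    fix x assume "x \<in> L"
    then obtain B where B: "x = Q B" using LQ by blast
    \<comment> \<open>As S is -d on representatives of \<open>L\<close>, the preimage of
      \<open>fls_deriv B\<close> is \<open>- B\<close>.\<close>
    then have "Q (- B) \<in> L" using vs2.subspace_neg[OF sub \<open>x \<in> L\<close>] by (simp add: neg)
    then have "fls_deriv (A (- B)) = fls_deriv (- B)" by (rule uniq) simp
    then have "fls_deriv B = S (- B)" by (simp add: S_def)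
    then show "x \<in> graph S" unfolding B Q_in_graph_iff by blast
  qed
  ultimately show ?thesis by blast
qed

end

lemma laurent_quotient_fls_deriv: "laurent_quotient scale_Omega (fls_deriv :: 'k::field_char_0 fls \<Rightarrow> _)"
proof -
  have "vector_space (scale_Omega :: 'k \<Rightarrow> _)"
    by standard (simp_all add: scale_Omega_def algebra_simps flip: fls_plus_const fls_const_mult_const)
  then have "Vector_Spaces.linear scale_Omega scale_Omega (fls_deriv :: 'k fls \<Rightarrow> _)"
    unfolding Vector_Spaces.linear_iff by (simp add: scale_Omega_def)
  then show ?thesis
    unfolding laurent_quotient_def laurent_quotient_axioms_def fls_deriv_eq_0_iff
    by (metis fls_const_nth rangeE rangeI)
qed

lemma range_fls_deriv: "range fls_deriv = (Omega_K' :: 'k::field_char_0 fls set)"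
  unfolding Omega_K'_def using fls_residue_nonzero_ex_anitderivative_iff by fastforce

lemma fls_deriv_image_Omega: "fls_deriv ` Omega = (Omega :: 'k::field_char_0 fls set)"
proof (intro equalityI subsetI)
  fix h :: "'k fls" assume "h \<in> Omega"
  then show "h \<in> fls_deriv ` Omega"
    by (intro image_eqI[of _ _ "fls_integral h"])
      (simp_all add: fls_deriv_fls_integral residue_Omega fls_integral_in_Omega del: fls_residue_def)
qed (auto simp: fls_deriv_in_Omega_iff)

lemma graph_fls_deriv:
  assumes "lagrangian_operator S"
  shows "laurent_quotient.graph fls_deriv S = range S"
proof -
  interpret laurent_quotient scale_Omega "fls_deriv :: 'a fls \<Rightarrow> _" by (rule laurent_quotient_fls_deriv)
  have "S F \<in> fls_deriv ` {A. fls_deriv A \<in> range S}" for F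
    by (rule image_eqI[of _ _ "fls_integral (S F)"]) (simp_all add: lop_deriv_integral[OF assms])
  then show ?thesis unfolding graph_def by auto
qed

section \<open>The induced endomorphisms of K'\<close>

lemma S_fls_O2_in_Omega:
  assumes "\<xi> \<in> O2"
  shows "S_fls \<xi> F \<in> Omega"
proof (induction F rule: fls_polar_induct)
  case (Omega f)
  have "S_fls \<xi> f = 0" using assms Omega by (intro S_fls_Omega) (simp_all add: O2_iff)
  then show ?case by simp
next
  case (polar c n)
  then show ?case unfolding S_fls_scale S_fls_polar using assms by (intro Omega_scale) (simp add: O2_iff)
qed (simp add: S_fls_add Omega_add)

lemma S_op_eq: "S_op \<phi> \<eta> = (\<lambda>f. S_fls \<eta> (\<phi> f))"
  by (simp add: S_op_def S_fls_def fun_eq_iff)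

lemma R_op_eq:
  assumes "\<eta> \<in> Omega2_hat_sym_1"
  shows "R_op \<phi> \<eta> = (\<lambda>f. fls_deriv (\<phi> f :: 'k::field_char_0 fls))"
  by (simp add: R_op_def Res12_eq[OF assms] fun_eq_iff)

lemma induced_form_surj:
  assumes "surj \<phi>"
  shows "induced_form \<phi> (\<lambda>f. p (\<phi> f)) = induced_form (\<lambda>F. F) p"
proof -
  have "(\<exists>f g. p (\<phi> f) = x \<and> p (\<phi> g) = y \<and> c = fls_residue (\<phi> f * fls_deriv (\<phi> g)))
     \<longleftrightarrow> (\<exists>F G. p F = x \<and> p G = y \<and> c = fls_residue (F * fls_deriv G))" for x y c
    using assms by (metis surjD)
  then show ?thesis unfolding induced_form_def pairing_def diff_K_def fun_eq_iff by simp
qed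

text \<open>Separates the operators from the arithmetic of O: the expansion enters as a surjection
  \<open>\<phi>\<close> onto k((t)) through which \<open>q\<close> factors. Values on K' are then
  computed on representatives in k((t)).\<close>

locale laurent_model = laurent_quotient scale Q
  for scale :: "'k::field_char_0 \<Rightarrow> 'v::ab_group_add \<Rightarrow> 'v" and Q :: "'k fls \<Rightarrow> 'v" +
  fixes \<phi> :: "'K \<Rightarrow> 'k fls" and q :: "'K \<Rightarrow> 'v"
  assumes surj_\<phi>: "surj \<phi>" and surj_Q: "surj Q" and q_eq: "q f = Q (\<phi> f)"
begin

lemma Q_cases: obtains F where "x = Q F"
  using surjD[OF surj_Q, of x] by blast

lemma Collect_Q:
  assumes "\<And>F. P (Q F) \<longleftrightarrow> Q F \<in> X"
  shows "{x. P x} = X"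
proof -
  have "P x \<longleftrightarrow> x \<in> X" for x using assms by (cases x rule: Q_cases) simp
  then show ?thesis by blast
qed

lemma factor_eq:
  assumes "\<And>G. Q G = Q F \<Longrightarrow> T G = T F"
  shows "factor q (\<lambda>f. T (\<phi> f)) (Q F) = T F"
  unfolding factor_def q_eq
proof (rule the_equality)
  obtain f where "\<phi> f = F" using surj_\<phi> by (metis surjD)
  then show "\<exists>f. Q (\<phi> f) = Q F \<and> T F = T (\<phi> f)" by blast
qed (use assms in blast)

lemma diff_K'_Q: "diff_K' \<phi> q (Q F) = fls_deriv F"
  unfolding diff_K'_def diff_K_def by (rule factor_eq[of F fls_deriv]) (simp add: Q_eq_iff)

lemma inj_diff_K': "inj (diff_K' \<phi> q)"
proof (rule injI)
  fix x y assume "diff_K' \<phi> q x = diff_K' \<phi> q y"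
  moreover obtain F G where "x = Q F" "y = Q G" using surj_Q by (metis surjD)
  ultimately show "x = y" by (simp add: diff_K'_Q Q_eq_iff)
qed

text \<open>\<open>inv\<close> of the injective map \<open>diff_K'\<close> is meaningful on its
  range, the differentials with residue zero; the primitive \<open>A\<close> certifies that
  \<open>T F\<close> lies there.\<close>

lemma endo_eq:
  assumes "\<And>G. Q G = Q F \<Longrightarrow> T G = T F" "fls_deriv A = T F"
  shows "endo_K' \<phi> q (\<lambda>f. T (\<phi> f)) (Q F) = Q A"
proof -
  have "factor q (\<lambda>f. T (\<phi> f)) (Q F) = T F"
    using assms(1) by (rule factor_eq)
  then have "factor q (\<lambda>f. T (\<phi> f)) (Q F) = diff_K' \<phi> q (Q A)"
    by (simp only: diff_K'_Q assms(2))
  then show ?thesis unfolding endo_K'_def using inv_f_f[OF inj_diff_K'] by simp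
qed

lemma q_form: "induced_form \<phi> q = form"
proof -
  have "q = (\<lambda>f. Q (\<phi> f))" by (simp add: q_eq fun_eq_iff)
  then show ?thesis using induced_form_surj[OF surj_\<phi>] by metis
qed

lemma S_fls_respects:
  assumes "\<xi> \<in> O2 \<or> \<xi> \<in> Omega2_hat_sym_1" "Q G = Q F"
  shows "S_fls \<xi> G = S_fls \<xi> F"
proof -
  obtain c where "G = fls_const c + F" using assms(2) unfolding Q_eq_iff fls_deriv_eq_iff_ex by blast
  moreover have "S_fls \<xi> (fls_const c) = 0"
    using assms(1)
  proof
    assume "\<xi> \<in> O2"
    then show ?thesis by (intro S_fls_Omega) (simp_all add: O2_iff)
  qed (simp add: lop_Omega[OF lagrangian_operator_S_fls])
  ultimately show ?thesis by (simp add: S_fls_add)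
qed

lemma rho_Q:
  assumes "\<xi> \<in> O2"
  shows "rho \<phi> q \<xi> (Q F) = Q (F + fls_integral (S_fls \<xi> F))"
proof -
  have "fls_deriv (fls_integral (S_fls \<xi> F)) = S_fls \<xi> F"
    by (intro fls_deriv_fls_integral residue_Omega S_fls_O2_in_Omega assms)
  then have "endo_K' \<phi> q (\<lambda>f. S_fls \<xi> (\<phi> f)) (Q F) = Q (fls_integral (S_fls \<xi> F))"
    using S_fls_respects[OF disjI1[OF assms]] by (intro endo_eq[of F "S_fls \<xi>"])
  then show ?thesis unfolding rho_def add by (simp add: S_fls_def)
qed

context
  fixes \<eta> :: "'k fls fls"
  assumes \<eta>: "\<eta> \<in> Omega2_hat_sym_1"
begin

lemma operator: "lagrangian_operator (S_fls \<eta>)"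
  using \<eta> by (rule lagrangian_operator_S_fls)

lemma S'_Q: "S'_op \<phi> q \<eta> (Q F) = Q (fls_integral (S_fls \<eta> F))"
  unfolding S'_op_def S_op_eq
proof (rule endo_eq[of F "S_fls \<eta>"])
  show "S_fls \<eta> G = S_fls \<eta> F" if "Q G = Q F" for G
    using \<eta> that by (blast intro: S_fls_respects)
qed (rule lop_deriv_integral[OF operator])

lemma Pi_Q: "Pi_op \<phi> q \<eta> (Q F) = Q (F + fls_integral (S_fls \<eta> F))"
  unfolding Pi_op_def R_op_eq[OF \<eta>] S_op_eq
proof (rule endo_eq[of F "\<lambda>F. fls_deriv F + S_fls \<eta> F"])
  fix G assume "Q G = Q F"
  then show "fls_deriv G + S_fls \<eta> G = fls_deriv F + S_fls \<eta> F"
    using S_fls_respects[OF disjI2[OF \<eta>], of G F] by (simp add: Q_eq_iff)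
next
  show "fls_deriv (F + fls_integral (S_fls \<eta> F)) = fls_deriv F + S_fls \<eta> F"
    by (simp add: lop_deriv_integral[OF operator])
qed

lemma Pi_argument_in_Omega: "F + fls_integral (S_fls \<eta> F) \<in> Omega"
proof -
  have "fls_deriv (F + fls_integral (S_fls \<eta> F)) \<in> Omega"
    using lop_near[OF operator, of F] by (simp add: lop_deriv_integral[OF operator] add.commute)
  then show ?thesis unfolding fls_deriv_in_Omega_iff .
qed

lemma vector_space_scale: "vector_space scale"
  by unfold_locales

lemma linear_S': "Vector_Spaces.linear scale scale (S'_op \<phi> q \<eta>)"
  unfolding Vector_Spaces.linear_iff
proof (intro conjI allI vector_space_scale)
  fix x y
  obtain F G where x: "x = Q F" "y = Q G" using surj_Q by (metis surjD)
  show "S'_op \<phi> q \<eta> (x + y) = S'_op \<phi> q \<eta> x + S'_op \<phi> q \<eta> y"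
    unfolding x add[symmetric] S'_Q by (simp add: S_fls_add)
next
  fix c x
  obtain F where x: "x = Q F" using surj_Q by (metis surjD)
  show "S'_op \<phi> q \<eta> (scale c x) = scale c (S'_op \<phi> q \<eta> x)"
    unfolding x Q_scale[symmetric] S'_Q by (simp add: S_fls_scale fls_integral_mult_const_left)
qed

lemma linear_Pi: "Vector_Spaces.linear scale scale (Pi_op \<phi> q \<eta>)"
  unfolding Vector_Spaces.linear_iff
proof (intro conjI allI vector_space_scale)
  fix x y
  obtain F G where x: "x = Q F" "y = Q G" using surj_Q by (metis surjD)
  show "Pi_op \<phi> q \<eta> (x + y) = Pi_op \<phi> q \<eta> x + Pi_op \<phi> q \<eta> y"
    unfolding x add[symmetric] Pi_Q by (simp add: S_fls_add add_ac)
next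
  fix c x
  obtain F where x: "x = Q F" using surj_Q by (metis surjD)
  show "Pi_op \<phi> q \<eta> (scale c x) = scale c (Pi_op \<phi> q \<eta> x)"
    unfolding x Q_scale[symmetric] Pi_Q
    by (simp add: S_fls_scale fls_integral_mult_const_left distrib_left)
qed

lemma projector_minus_S': "projector scale (\<lambda>x. - S'_op \<phi> q \<eta> x)"
  unfolding projector_def
proof
  show "Vector_Spaces.linear scale scale (\<lambda>x. - S'_op \<phi> q \<eta> x)"
    using linear_S' unfolding Vector_Spaces.linear_iff by (simp add: vs2.scale_minus_right)
  show "(\<lambda>x. - S'_op \<phi> q \<eta> x) \<circ> (\<lambda>x. - S'_op \<phi> q \<eta> x) = (\<lambda>x. - S'_op \<phi> q \<eta> x)"
  proof
    fix x
    obtain F where x: "x = Q F" using surj_Q by (metis surjD)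
    have "S_fls \<eta> (- fls_integral (S_fls \<eta> F)) = S_fls \<eta> F"
      using lop_idem[OF operator lop_deriv_integral[OF operator]] lop_uminus[OF operator] by simp
    then show "((\<lambda>x. - S'_op \<phi> q \<eta> x) \<circ> (\<lambda>x. - S'_op \<phi> q \<eta> x)) x = - S'_op \<phi> q \<eta> x"
      unfolding comp_def x S'_Q neg[symmetric] by simp
  qed
qed

lemma kernel_minus_S': "{x. - S'_op \<phi> q \<eta> x = 0} = Q ` Omega"
proof -
  have "- S'_op \<phi> q \<eta> (Q F) = 0 \<longleftrightarrow> Q F \<in> Q ` Omega" for F
    unfolding S'_Q neg_equal_0_iff_equal Q_eq_0_iff lop_deriv_integral[OF operator]
      lop_eq_0_iff[OF operator] Q_in_Omega_iff ..
  then show ?thesis by (rule Collect_Q)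
qed

lemma L_space_eq: "L_space \<phi> q \<eta> = graph (S_fls \<eta>)"
proof -
  have "L_space \<phi> q \<eta> = range (\<lambda>F. - S'_op \<phi> q \<eta> (Q F))"
    unfolding L_space_def by (auto elim: Q_cases) (metis Q_cases rangeI)
  also have "\<dots> = graph (S_fls \<eta>)"
  proof (intro equalityI subsetI)
    fix x assume "x \<in> range (\<lambda>F. - S'_op \<phi> q \<eta> (Q F))"
    then obtain F where x: "x = Q (- fls_integral (S_fls \<eta> F))" unfolding S'_Q neg by blast
    \<comment> \<open>The sign of -S' is absorbed by replacing \<open>F\<close> with
      \<open>- F\<close>.\<close>
    have "fls_deriv (- fls_integral (S_fls \<eta> F)) = S_fls \<eta> (- F)"
      by (simp add: lop_deriv_integral[OF operator] lop_uminus[OF operator])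
    then show "x \<in> graph (S_fls \<eta>)" unfolding x Q_in_graph_iff by blast
  next
    fix x assume "x \<in> graph (S_fls \<eta>)"
    then obtain A F where x: "x = Q A" "fls_deriv A = S_fls \<eta> F" unfolding graph_def by blast
    have "x = - S'_op \<phi> q \<eta> (Q (- F))"
      unfolding S'_Q x(1) neg[symmetric] Q_eq_iff
      by (simp add: lop_deriv_integral[OF operator] lop_uminus[OF operator] x(2))
    then show "x \<in> range (\<lambda>F. - S'_op \<phi> q \<eta> (Q F))" by blast
  qed
  finally show ?thesis .
qed

text \<open>The projection kills the class of F iff dF = - S F. By \<open>lop_idem\<close> this
  holds as soon as dF lies in the image of S, so the equation turns into membership.\<close>

lemma kernel_Pi: "{x. Pi_op \<phi> q \<eta> x = 0} = L_space \<phi> q \<eta>"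
proof -
  have "Pi_op \<phi> q \<eta> (Q F) = 0 \<longleftrightarrow> Q F \<in> graph (S_fls \<eta>)" for F
  proof -
    have "Pi_op \<phi> q \<eta> (Q F) = 0 \<longleftrightarrow> fls_deriv F = - S_fls \<eta> F"
      unfolding Pi_Q Q_eq_0_iff by (simp add: lop_deriv_integral[OF operator] eq_neg_iff_add_eq_0)
    also have "\<dots> \<longleftrightarrow> fls_deriv F \<in> range (S_fls \<eta>)"
    proof
      assume "fls_deriv F = - S_fls \<eta> F"
      then have "fls_deriv F = S_fls \<eta> (- F)" by (simp add: lop_uminus[OF operator])
      then show "fls_deriv F \<in> range (S_fls \<eta>)" by blast
    next
      assume "fls_deriv F \<in> range (S_fls \<eta>)"
      then obtain G where G: "fls_deriv F = S_fls \<eta> G" by blast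
      then show "fls_deriv F = - S_fls \<eta> F" using lop_idem[OF operator G] by simp
    qed
    finally show ?thesis unfolding Q_in_graph_iff .
  qed
  then show ?thesis unfolding L_space_eq by (rule Collect_Q)
qed

lemma supplement_L_space: "lagrangian_supplement scale UNIV form (Q ` Omega) (L_space \<phi> q \<eta>)"
  using lagrangian_supplement_graph[OF operator] unfolding L_space_eq surj_Q .

lemma Pi_fixes_Omega:
  assumes "f \<in> Omega"
  shows "Pi_op \<phi> q \<eta> (Q f) = Q f"
  unfolding Pi_Q lop_Omega[OF operator assms] by simp

lemma lagrangian_projection_Pi: "lagrangian_projection scale form (Q ` Omega) (Pi_op \<phi> q \<eta>)"
  unfolding lagrangian_projection_def projector_def
proof (intro conjI linear_Pi)
  have PiM: "Pi_op \<phi> q \<eta> x \<in> Q ` Omega" for x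
    using Pi_argument_in_Omega by (cases x rule: Q_cases) (simp add: Pi_Q)
  show "Pi_op \<phi> q \<eta> \<circ> Pi_op \<phi> q \<eta> = Pi_op \<phi> q \<eta>"
  proof
    fix x
    obtain f where "f \<in> Omega" "Pi_op \<phi> q \<eta> x = Q f" using PiM[of x] by blast
    then show "(Pi_op \<phi> q \<eta> \<circ> Pi_op \<phi> q \<eta>) x = Pi_op \<phi> q \<eta> x"
      by (simp add: Pi_fixes_Omega)
  qed
  show "range (Pi_op \<phi> q \<eta>) = Q ` Omega"
  proof (intro equalityI subsetI)
    fix x assume "x \<in> Q ` Omega"
    then obtain f where "f \<in> Omega" "x = Q f" by blast
    then have "x = Pi_op \<phi> q \<eta> x" by (simp add: Pi_fixes_Omega)
    then show "x \<in> range (Pi_op \<phi> q \<eta>)" by (rule range_eqI)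
  qed (use PiM in blast)
  show "lagrangian scale UNIV form {x. Pi_op \<phi> q \<eta> x = 0}"
    using supplement_L_space unfolding kernel_Pi lagrangian_supplement_def by blast
qed


end

end

section \<open>The torsor structures\<close>

lemma Omega2_sym_add: "\<xi> \<in> Omega2_sym \<Longrightarrow> \<zeta> \<in> Omega2_sym \<Longrightarrow> \<xi> + \<zeta> \<in> Omega2_sym"
  by (auto simp: Omega2_sym_iff O2_def)

lemma Omega2_sym_uminus: "\<xi> \<in> Omega2_sym \<Longrightarrow> - \<xi> \<in> Omega2_sym"
  by (auto simp: Omega2_sym_iff O2_def)

lemma Omega2_sym_0: "0 \<in> Omega2_sym"
  by (simp add: Omega2_sym_iff O2_def)

lemma Omega2_hat_sym_1_add:
  fixes \<eta> :: "'k::field_char_0 fls fls"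
  assumes "\<eta> \<in> Omega2_hat_sym_1" "\<xi> \<in> Omega2_sym"
  shows "\<eta> + \<xi> \<in> Omega2_hat_sym_1"
proof -
  obtain \<zeta> where "\<zeta> \<in> Omega2_sym" "\<eta> = diag_var powi (-2) + \<zeta>"
    using assms(1) unfolding Omega2_hat_sym_1_iff by blast
  then have "\<eta> + \<xi> = diag_var powi (-2) + (\<zeta> + \<xi>)" "\<zeta> + \<xi> \<in> Omega2_sym"
    using assms(2) by (simp_all add: Omega2_sym_add add.assoc)
  then show ?thesis unfolding Omega2_hat_sym_1_iff by blast
qed

lemma torsor_Omega2_hat_sym_1:
  "torsor Omega2_sym (\<lambda>\<xi> \<eta>. \<eta> + \<xi>) (Omega2_hat_sym_1 :: 'k::field_char_0 fls fls set)"
  unfolding torsor_def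
proof (intro conjI ballI)
  have "diag_var powi (-2) + 0 \<in> (Omega2_hat_sym_1 :: 'k fls fls set)"
    unfolding Omega2_hat_sym_1_iff using Omega2_sym_0 by blast
  then show "(Omega2_hat_sym_1 :: 'k fls fls set) \<noteq> {}" by blast
next
  fix \<eta> \<theta> :: "'k fls fls"
  assume "\<eta> \<in> Omega2_hat_sym_1" "\<theta> \<in> Omega2_hat_sym_1"
  then obtain \<xi> \<zeta> where "\<xi> \<in> Omega2_sym" "\<zeta> \<in> Omega2_sym" "\<eta> = diag_var powi (-2) + \<xi>" "\<theta> = diag_var powi (-2) + \<zeta>"
    unfolding Omega2_hat_sym_1_iff by blast
  then show "\<exists>!\<xi>. \<xi> \<in> Omega2_sym \<and> \<eta> + \<xi> = \<theta>"
    using Omega2_sym_add[OF \<open>\<zeta> \<in> Omega2_sym\<close> Omega2_sym_uminus[OF \<open>\<xi> \<in> Omega2_sym\<close>]]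
    by (intro ex1I[of _ "\<zeta> + - \<xi>"]) (auto simp: algebra_simps)
qed (simp_all add: Omega2_sym_0 Omega2_sym_add Omega2_sym_uminus Omega2_hat_sym_1_add)

text \<open>All torsor axioms for \<open>Y\<close>, the action laws included, are inherited along an
  equivariant bijection, so no group law for \<open>rho\<close> has to be verified.\<close>

lemma torsor_iso_transfer:
  assumes tors: "torsor G actX X" and bij: "bij_betw F X Y"
    and equiv: "\<And>g x. g \<in> G \<Longrightarrow> x \<in> X \<Longrightarrow> F (actX g x) = actY g (F x)"
  shows "torsor_iso G actX X actY Y F"
proof -
  have G: "0 \<in> G" "\<And>g h. g \<in> G \<Longrightarrow> h \<in> G \<Longrightarrow> g + h \<in> G" "\<And>g. g \<in> G \<Longrightarrow> - g \<in> G"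
    and act: "\<And>g x. g \<in> G \<Longrightarrow> x \<in> X \<Longrightarrow> actX g x \<in> X" "\<And>x. x \<in> X \<Longrightarrow> actX 0 x = x"
      "\<And>g h x. g \<in> G \<Longrightarrow> h \<in> G \<Longrightarrow> x \<in> X \<Longrightarrow> actX (g + h) x = actX g (actX h x)"
    and ne: "X \<noteq> {}" and ex1: "\<And>x y. x \<in> X \<Longrightarrow> y \<in> X \<Longrightarrow> \<exists>!g. g \<in> G \<and> actX g x = y"
    using tors unfolding torsor_def by blast+
  have Y: "Y = F ` X" and inj: "inj_on F X" using bij by (auto simp: bij_betw_def)
  have "torsor G actY Y"
    unfolding torsor_def Y ball_simps
  proof (intro conjI ballI)
    fix x y assume xy: "x \<in> X" "y \<in> X"
    have "g \<in> G \<and> actX g x = y \<longleftrightarrow> g \<in> G \<and> actY g (F x) = F y" for g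
      using xy equiv[of g x] act(1)[of g x] inj_onD[OF inj, of "actX g x" y] by auto
    then show "\<exists>!g. g \<in> G \<and> actY g (F x) = F y" using ex1[OF xy] by simp
  next
    fix g h x assume gh: "g \<in> G" "h \<in> G" and x: "x \<in> X"
    show "actY (g + h) (F x) = actY g (actY h (F x))"
      using gh x G act by (simp flip: equiv)
  qed (use G act ne in \<open>auto simp flip: equiv\<close>)
  then show ?thesis unfolding torsor_iso_def using assms by blast
qed

context laurent_model
begin

text \<open>\<open>S_fls \<eta>\<close> kills the regular series d^(-1) S_fls \<xi> F, so composing
  with \<open>rho\<close> adds exactly this series to the value.\<close>

lemma Pi_add:
  assumes \<eta>: "\<eta> \<in> Omega2_hat_sym_1" and \<xi>: "\<xi> \<in> Omega2_sym"
  shows "Pi_op \<phi> q (\<eta> + \<xi>) = Pi_op \<phi> q \<eta> \<circ> rho \<phi> q \<xi>"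
proof
  fix x
  obtain F where x: "x = Q F" by (rule Q_cases)
  have \<xi>O: "\<xi> \<in> O2" using \<xi> by (simp add: Omega2_sym_def)
  let ?I = "fls_integral (S_fls \<xi> F)"
  have "S_fls \<eta> (F + ?I) = S_fls \<eta> F"
    unfolding S_fls_add using lop_Omega[OF operator[OF \<eta>] fls_integral_in_Omega[OF S_fls_O2_in_Omega[OF \<xi>O]]]
    by simp
  then show "Pi_op \<phi> q (\<eta> + \<xi>) x = (Pi_op \<phi> q \<eta> \<circ> rho \<phi> q \<xi>) x"
    unfolding comp_def x rho_Q[OF \<xi>O] Pi_Q[OF \<eta>] Pi_Q[OF Omega2_hat_sym_1_add[OF \<eta> \<xi>]]
    by (simp add: S_fls_add_right add_ac)
qed

text \<open>Kernels are taken in \<open>Pi_add\<close>: the kernel of a composition is a preimage,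
  which is the action of the inverse of \<open>rho\<close> on supplements.\<close>

lemma L_space_add:
  assumes "\<eta> \<in> Omega2_hat_sym_1" "\<xi> \<in> Omega2_sym"
  shows "L_space \<phi> q (\<eta> + \<xi>) = rho \<phi> q \<xi> -` L_space \<phi> q \<eta>"
  unfolding kernel_Pi[OF assms(1), symmetric] kernel_Pi[OF Omega2_hat_sym_1_add[OF assms], symmetric]
    Pi_add[OF assms] by auto

lemma bij_betw_L_space:
  "bij_betw (L_space \<phi> q) Omega2_hat_sym_1 {L. lagrangian_supplement scale UNIV form (Q ` Omega) L}"
proof (rule bij_betwI')
  fix \<eta> \<theta> :: "'k fls fls" assume \<eta>\<theta>: "\<eta> \<in> Omega2_hat_sym_1" "\<theta> \<in> Omega2_hat_sym_1"
  show "L_space \<phi> q \<eta> = L_space \<phi> q \<theta> \<longleftrightarrow> \<eta> = \<theta>"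
    unfolding L_space_eq[OF \<eta>\<theta>(1)] L_space_eq[OF \<eta>\<theta>(2)]
    using graph_inj[OF operator operator, OF \<eta>\<theta>] S_fls_inj[OF \<eta>\<theta>] by blast
next
  fix \<eta> :: "'k fls fls" assume "\<eta> \<in> Omega2_hat_sym_1"
  then show "L_space \<phi> q \<eta> \<in> {L. lagrangian_supplement scale UNIV form (Q ` Omega) L}"
    using supplement_L_space by blast
next
  fix L assume "L \<in> {L. lagrangian_supplement scale UNIV form (Q ` Omega) L}"
  then obtain S where S: "lagrangian_operator S" "graph S = L"
    using lagrangian_supplement_ex_operator[of L] unfolding surj_Q by blast
  obtain \<eta> where "\<eta> \<in> Omega2_hat_sym_1" "S_fls \<eta> = S" using lop_ex_S_fls[OF S(1)] by blast
  then show "\<exists>\<eta>\<in>Omega2_hat_sym_1. L = L_space \<phi> q \<eta>" using L_space_eq S(2) by blast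
qed

lemma torsor_iso_L_space:
  "torsor_iso Omega2_sym (\<lambda>\<xi> \<eta>. \<eta> + \<xi>) Omega2_hat_sym_1 (\<lambda>\<xi> L. rho \<phi> q \<xi> -` L)
     {L. lagrangian_supplement scale UNIV form (Q ` Omega) L} (L_space \<phi> q)"
  by (intro torsor_iso_transfer torsor_Omega2_hat_sym_1 bij_betw_L_space L_space_add)

text \<open>The instance \<open>Q = fls_deriv\<close> of \<open>lagrangian_supplement_graph\<close>,
  in which d^(-1) S(K) becomes the image of S itself.\<close>

lemma range_S_supplement:
  assumes "\<eta> \<in> Omega2_hat_sym_1"
  shows "lagrangian_supplement scale_Omega Omega_K' (induced_form \<phi> (diff_K \<phi>)) Omega (range (S_op \<phi> \<eta>))"
proof -
  interpret D: laurent_quotient scale_Omega "fls_deriv :: 'k fls \<Rightarrow> 'k fls"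
    by (rule laurent_quotient_fls_deriv)
  have "range (S_op \<phi> \<eta>) = range (S_fls \<eta>)"
    unfolding S_op_eq using surj_\<phi> by (metis image_image)
  then show ?thesis
    using D.lagrangian_supplement_graph[OF operator[OF assms]]
    unfolding graph_fls_deriv[OF operator[OF assms]] range_fls_deriv fls_deriv_image_Omega
      induced_form_surj[OF surj_\<phi>, symmetric] diff_K_def[abs_def] by simp
qed

end

theorem proposition2p3:
  fixes \<iota> :: "'k::field_char_0 \<Rightarrow> 'o::idom"
    and t :: 'o
    and scale :: "'k \<Rightarrow> 'v::ab_group_add \<Rightarrow> 'v"
    and q :: "'o fract \<Rightarrow> 'v"
    and \<phi> :: "'o fract \<Rightarrow> 'k fls"
  assumes "complete_dv_algebra \<iota>"
    and "irreducible t"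
    and "\<phi> = laurent_expansion \<iota> t"
    and "quotient_by_constants \<iota> scale q"
  shows "(\<forall>\<eta> \<in> Omega2_hat_sym_1.
          (\<forall>f. Res12 (pullback1 (\<phi> f) * \<eta>) = diff_K \<phi> f)
        \<and> (\<forall>f \<in> range to_fract. S_op \<phi> \<eta> f = 0)
        \<and> lagrangian_supplement scale_Omega Omega_K' (induced_form \<phi> (diff_K \<phi>)) Omega (range (S_op \<phi> \<eta>))
        \<and> Vector_Spaces.linear scale scale (S'_op \<phi> q \<eta>)
        \<and> (\<forall>f. diff_K' \<phi> q (S'_op \<phi> q \<eta> (q f)) = S_op \<phi> \<eta> f)
        \<and> projector scale (\<lambda>x. - S'_op \<phi> q \<eta> x)
        \<and> {x. - S'_op \<phi> q \<eta> x = 0} = max_ideal' q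
        \<and> lagrangian_supplement scale UNIV (induced_form \<phi> q) (max_ideal' q) (L_space \<phi> q \<eta>)
        \<and> (\<forall>f. diff_K' \<phi> q (Pi_op \<phi> q \<eta> (q f))
                = Res12 (pullback1 (\<phi> f) * \<eta>) + Res1 (pullback1 (\<phi> f) * \<eta>))
        \<and> lagrangian_projection scale (induced_form \<phi> q) (max_ideal' q) (Pi_op \<phi> q \<eta>)
        \<and> {x. Pi_op \<phi> q \<eta> x = 0} = L_space \<phi> q \<eta>)
       \<and> torsor_iso Omega2_sym
          (\<lambda>\<xi> \<eta>. \<eta> + \<xi>) Omega2_hat_sym_1
          (\<lambda>\<xi> L. rho \<phi> q \<xi> -` L)
          {L. lagrangian_supplement scale UNIV (induced_form \<phi> q) (max_ideal' q) L}
          (L_space \<phi> q)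
       \<and> (\<forall>\<xi> \<in> Omega2_sym. \<forall>\<eta> \<in> Omega2_hat_sym_1. Pi_op \<phi> q (\<eta> + \<xi>) = Pi_op \<phi> q \<eta> \<circ> rho \<phi> q \<xi>)"
proof -
  interpret uniformized_dv_algebra \<iota> t
    using assms(1,2) unfolding uniformized_dv_algebra_def uniformized_dv_algebra_axioms_def by blast
  have \<phi>: "\<phi> = lexp" by (rule assms(3))
  have bij: "bij \<phi>" unfolding \<phi> by (rule bij_lexp)
  have lin: "Vector_Spaces.linear (scale_K \<iota>) scale q" and "surj q"
    and ker: "\<And>f. q f = 0 \<longleftrightarrow> f \<in> range (\<lambda>c. to_fract (\<iota> c))"
    using assms(4) unfolding quotient_by_constants_def by blast+
  interpret q: Vector_Spaces.linear "scale_K \<iota>" scale q by (rule lin)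
  \<comment> \<open>Transports the quotient map to k((t)), where the preceding results
    apply.\<close>
  define Q where "Q F = q (inv \<phi> F)" for F
  have q_Q: "q f = Q (\<phi> f)" for f using bij by (simp add: Q_def bij_is_inj)
  have inv_add: "inv \<phi> (F + G) = inv \<phi> F + inv \<phi> G" for F G
    by (intro inv_f_eq bij_is_inj[OF bij]) (simp add: \<phi> lexp_add surj_f_inv_f[OF bij_is_surj[OF bij_lexp]])
  have inv_scale: "inv \<phi> (fls_const c * F) = scale_K \<iota> c (inv \<phi> F)" for c F
    by (intro inv_f_eq bij_is_inj[OF bij]) (simp add: \<phi> lexp_scale surj_f_inv_f[OF bij_is_surj[OF bij_lexp]])
  have const: "\<phi> (to_fract (\<iota> c)) = fls_const c" for c
    by (simp add: \<phi> lexp_to_fract pse_iota)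
  interpret D: laurent_quotient scale_Omega "fls_deriv :: 'k fls \<Rightarrow> 'k fls"
    by (rule laurent_quotient_fls_deriv)
  have linQ: "Vector_Spaces.linear scale_Omega scale Q"
    unfolding Vector_Spaces.linear_iff Q_def scale_Omega_def inv_add inv_scale
    using D.vs1.vector_space_axioms q.vs2.vector_space_axioms
    by (simp add: q.add q.scale scale_Omega_def[abs_def])
  have kerQ: "Q F = 0 \<longleftrightarrow> F \<in> range fls_const" for F
  proof -
    have "Q F = 0 \<longleftrightarrow> (\<exists>c. inv \<phi> F = to_fract (\<iota> c))" unfolding Q_def ker by blast
    also have "\<dots> \<longleftrightarrow> (\<exists>c. F = \<phi> (to_fract (\<iota> c)))"
      using bij by (metis bij_inv_eq_iff)
    finally show ?thesis unfolding const by blast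
  qed
  have "surj Q"
    unfolding Q_def using \<open>surj q\<close> bij by (metis Q_def q_Q surjD surjI surj_def)
  interpret laurent_model scale Q \<phi> q
    unfolding laurent_model_def laurent_quotient_def laurent_quotient_axioms_def laurent_model_axioms_def
    using linQ kerQ \<open>surj Q\<close> bij_is_surj[OF bij] q_Q by blast
  have \<phi>_range: "\<phi> ` range to_fract = Omega" unfolding \<phi> by (rule lexp_image_range)
  \<comment> \<open>m and O have the same image in K': subtracting its residue moves an element of O
    into m without changing its class, and \<open>\<phi>\<close> carries O onto
    \<open>Omega\<close>.\<close>
  have max: "max_ideal' q = Q ` Omega"
  proof -
    have "q (to_fract x) \<in> q ` to_fract ` max_ideal" for x
    proof -
      obtain c where c: "x - \<iota> c \<in> max_ideal" using residue_field[of x] by blast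
      have "q (to_fract (x - \<iota> c)) = q (to_fract x)"
        using ker[of "to_fract (\<iota> c)"] by (simp add: q.diff)
      then show ?thesis using c by (metis imageI)
    qed
    then have "max_ideal' q = q ` range to_fract" unfolding max_ideal'_def by blast
    also have "\<dots> = Q ` \<phi> ` range to_fract" by (simp add: image_image q_Q)
    finally show ?thesis unfolding \<phi>_range .
  qed
  have main: "(\<forall>f. Res12 (pullback1 (\<phi> f) * \<eta>) = diff_K \<phi> f)
        \<and> (\<forall>f \<in> range to_fract. S_op \<phi> \<eta> f = 0)
        \<and> (\<forall>f. diff_K' \<phi> q (S'_op \<phi> q \<eta> (q f)) = S_op \<phi> \<eta> f)
        \<and> (\<forall>f. diff_K' \<phi> q (Pi_op \<phi> q \<eta> (q f))
                = Res12 (pullback1 (\<phi> f) * \<eta>) + Res1 (pullback1 (\<phi> f) * \<eta>))"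
    if \<eta>: "\<eta> \<in> Omega2_hat_sym_1" for \<eta>
  proof (intro conjI allI ballI)
    note int = lop_deriv_integral[OF operator[OF \<eta>]]
    fix f
    show "Res12 (pullback1 (\<phi> f) * \<eta>) = diff_K \<phi> f"
      unfolding diff_K_def by (rule Res12_eq[OF \<eta>])
    show "diff_K' \<phi> q (S'_op \<phi> q \<eta> (q f)) = S_op \<phi> \<eta> f"
      unfolding q_Q S'_Q[OF \<eta>] diff_K'_Q int S_op_eq ..
    show "diff_K' \<phi> q (Pi_op \<phi> q \<eta> (q f)) = Res12 (pullback1 (\<phi> f) * \<eta>) + Res1 (pullback1 (\<phi> f) * \<eta>)"
      unfolding q_Q Pi_Q[OF \<eta>] diff_K'_Q Res12_eq[OF \<eta>] fls_deriv_add int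
      by (simp only: S_fls_def)
  next
    fix f :: "'o fract" assume "f \<in> range to_fract"
    then have "\<phi> f \<in> Omega" using \<phi>_range by blast
    then show "S_op \<phi> \<eta> f = 0" unfolding S_op_eq by (rule lop_Omega[OF operator[OF \<eta>]])
  qed
  show ?thesis
    unfolding max q_form
    using main range_S_supplement linear_S' projector_minus_S' kernel_minus_S' supplement_L_space
      lagrangian_projection_Pi kernel_Pi torsor_iso_L_space Pi_add
    by (intro conjI ballI) blast+
qed

end
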